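(* Let $T=(V,E)$ be an unknown undirected tree with $|V|=n$ whose maximum degree is bounded by a fixed constant $d$, and suppose an algorithm is given only $V$ and access to separator queries on $T$. If $T$ has height $h$, there is a deterministic algorithm that determines $E$ using $O(nh)$ separator queries; for $T$ of arbitrary height, there is a deterministic algorithm that determines $E$ using $O(n^{3/2}\sqrt{\log n})$ separator queries.
   Context: A separator query on an undirected tree $T=(V,E)$ is a function $\mathrm{sep}:V\times V\times V\to\{0,1\}$ with $\mathrm{sep}(a,b,c)=1$ if removing vertex $b$ disconnects vertex $a$ from vertex $c$ in $T$, and $\mathrm{sep}(a,b,c)=0$ otherwise. The tree $T$ has height $h$ if, when rooted at some vertex, every vertex is at distance at most $h$ from the root. The cost of an algorithm is the total number of separator queries it issues. *)

theory Defs
  imports Complex_Main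
begin

text \<open>Undirected simple graphs on a finite vertex set \<open>V\<close>; an edge is a two-element set.\<close>

definition simple_graph :: "'v set \<Rightarrow> 'v set set \<Rightarrow> bool" where
  "simple_graph V E \<longleftrightarrow> finite V \<and> (\<forall>e\<in>E. \<exists>u\<in>V. \<exists>v\<in>V. u \<noteq> v \<and> e = {u, v})"

text \<open>Walks are nonempty vertex lists; a walk \<open>p\<close> uses \<open>length p - 1\<close> edges.\<close>

definition walk :: "'v set \<Rightarrow> 'v set set \<Rightarrow> 'v \<Rightarrow> 'v list \<Rightarrow> 'v \<Rightarrow> bool" where
  "walk V E u p v \<longleftrightarrow>
     p \<noteq> [] \<and> hd p = u \<and> last p = v \<and> set p \<subseteq> V \<and> successively (\<lambda>x y. {x, y} \<in> E) p"

definition joined :: "'v set \<Rightarrow> 'v set set \<Rightarrow> 'v \<Rightarrow> 'v \<Rightarrow> bool" where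
  "joined V E u v \<longleftrightarrow> (\<exists>p. walk V E u p v)"

definition graph_cycle :: "'v set \<Rightarrow> 'v set set \<Rightarrow> 'v list \<Rightarrow> bool" where
  "graph_cycle V E p \<longleftrightarrow>
     length p \<ge> 3 \<and> distinct p \<and> set p \<subseteq> V \<and>
     successively (\<lambda>x y. {x, y} \<in> E) p \<and> {last p, hd p} \<in> E"

definition is_tree :: "'v set \<Rightarrow> 'v set set \<Rightarrow> bool" where
  "is_tree V E \<longleftrightarrow>
     simple_graph V E \<and> V \<noteq> {} \<and> (\<forall>u\<in>V. \<forall>v\<in>V. joined V E u v) \<and> (\<nexists>p. graph_cycle V E p)"

definition vertex_degree :: "'v set set \<Rightarrow> 'v \<Rightarrow> nat" where
  "vertex_degree E v = card {e \<in> E. v \<in> e}"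

definition max_degree :: "'v set \<Rightarrow> 'v set set \<Rightarrow> nat" where
  "max_degree V E = Max (vertex_degree E ` V)"

definition graph_dist :: "'v set \<Rightarrow> 'v set set \<Rightarrow> 'v \<Rightarrow> 'v \<Rightarrow> nat" where
  "graph_dist V E u v = (LEAST k. \<exists>p. walk V E u p v \<and> length p = Suc k)"

definition has_height :: "'v set \<Rightarrow> 'v set set \<Rightarrow> nat \<Rightarrow> bool" where
  "has_height V E h \<longleftrightarrow> (\<exists>r\<in>V. \<forall>v\<in>V. graph_dist V E r v \<le> h)"

text \<open>
  The answer 1 is \<open>True\<close>. Removing \<open>b\<close> can only separate two surviving vertices, so the answer is 0
  if \<open>b\<close> is one of the end points. It is also 0 on triples that do not lie in \<open>V\<close>.
\<close>

definition sep :: "'v set \<Rightarrow> 'v set set \<Rightarrow> 'v \<Rightarrow> 'v \<Rightarrow> 'v \<Rightarrow> bool" where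
  "sep V E a b c \<longleftrightarrow>
     a \<in> V \<and> b \<in> V \<and> c \<in> V \<and> a \<noteq> b \<and> c \<noteq> b \<and> \<not> joined (V - {b}) {e \<in> E. b \<notin> e} a c"

text \<open>
  A deterministic adaptive algorithm is a decision tree: it either stops with an output, or issues
  one query on a triple and continues depending on the answer. Only queries are charged.
\<close>

datatype ('v, 'r) query_alg =
    Output 'r
  | Query 'v 'v 'v "bool \<Rightarrow> ('v, 'r) query_alg"

primrec result :: "('v \<Rightarrow> 'v \<Rightarrow> 'v \<Rightarrow> bool) \<Rightarrow> ('v, 'r) query_alg \<Rightarrow> 'r" where
  "result orc (Output r) = r"
| "result orc (Query a b c k) = result orc (k (orc a b c))"

primrec query_count :: "('v \<Rightarrow> 'v \<Rightarrow> 'v \<Rightarrow> bool) \<Rightarrow> ('v, 'r) query_alg \<Rightarrow> nat" where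
  "query_count orc (Output r) = 0"
| "query_count orc (Query a b c k) = Suc (query_count orc (k (orc a b c)))"

end

theory Submission
  imports Defs "HOL-Library.FuncSet"
begin

text \<open>
  Fix a root \<open>r\<close>. The vertices lying on every walk from \<open>r\<close> to \<open>c\<close> are the ancestors of \<open>c\<close>, one
  ancestor test costs one separator query, and the edges are the covering pairs of the ancestor
  order. An algorithm works on a connected part \<open>X\<close> with top vertex \<open>w\<close> and cuts it at some vertex
  \<open>b\<close> into the descendants of \<open>b\<close> and the rest; this costs \<open>O(card X)\<close> queries.

  Always cutting at a child of \<open>w\<close> costs, up to a constant factor, the number of pairs of a covering
  pair and a descendant of its upper vertex, which is \<open>O(nh)\<close> when degrees are bounded.

  For the general bound, let \<open>s = card X\<close>, let \<open>L\<close> exceed \<open>log n\<close>, and divide \<open>X\<close> into about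
  \<open>sqrt (s L)\<close> blocks. Test every vertex \<open>b\<close> against its own block and \<open>2 L\<close> further blocks, chosen (by
  the probabilistic method) such that, for every large subset of \<open>X\<close>, fewer than about \<open>sqrt (s L)\<close>
  vertices have only test blocks that it barely meets. Call \<open>b\<close> a candidate if it has many
  descendants in some tested block. Cut at a candidate without candidates of its own block below it
  and keep the larger side: if this side is below \<open>b\<close>, the block is exhausted, and otherwise many
  vertices have been removed. Once no candidates are left, cut at children of \<open>w\<close>. Moving down from
  \<open>w\<close> then happens fewer than \<open>sqrt (s L)\<close> times, because every vertex passed is an ancestor of all
  that remains although it was no candidate. So after \<open>O(sqrt (s L))\<close> cuts all parts have at most
  \<open>7 s / 8\<close> vertices, and the costs of the recursion form a geometric series.
\<close>

section \<open>Query complexity over a class of instances\<close>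

primrec bind_alg ::
  "('v, 'r) query_alg \<Rightarrow> ('r \<Rightarrow> ('v, 's) query_alg) \<Rightarrow> ('v, 's) query_alg" where
  "bind_alg (Output r) f = f r"
| "bind_alg (Query a b c k) f = Query a b c (\<lambda>x. bind_alg (k x) f)"

lemma result_bind_alg [simp]: "result orc (bind_alg A f) = result orc (f (result orc A))"
  by (induction A) auto

lemma query_count_bind_alg [simp]:
  "query_count orc (bind_alg A f) = query_count orc A + query_count orc (f (result orc A))"
  by (induction A) auto

text \<open>
  \<open>I\<close> is the class of instances that agree with all answers received so far. Since the algorithm may
  depend on \<open>I\<close>, whatever is constant on \<open>I\<close> is known to it.
\<close>

definition computes ::
  "('i \<Rightarrow> 'v \<Rightarrow> 'v \<Rightarrow> 'v \<Rightarrow> bool) \<Rightarrow> 'i set \<Rightarrow> ('i \<Rightarrow> 'r) \<Rightarrow> ('i \<Rightarrow> real) \<Rightarrow> bool" where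
  "computes orc I f c \<longleftrightarrow>
     (\<exists>A. \<forall>i\<in>I. result (orc i) A = f i \<and> real (query_count (orc i) A) \<le> c i)"

lemma computes_mono:
  assumes "computes orc J f c" and "I \<subseteq> J"
    and "\<And>i. i \<in> I \<Longrightarrow> g i = f i" and "\<And>i. i \<in> I \<Longrightarrow> c i \<le> c' i"
  shows "computes orc I g c'"
  using assms unfolding computes_def by (metis order_trans subsetD)

lemma computes_const:
  assumes "\<And>i. i \<in> I \<Longrightarrow> f i = x" and "\<And>i. i \<in> I \<Longrightarrow> 0 \<le> c i"
  shows "computes orc I f c"
  unfolding computes_def using assms by (intro exI[of _ "Output x"]) auto

text \<open>Once the value \<open>x\<close> of \<open>f\<close> is known, only the instances with
  that value remain, so the continuation may be chosen separately for each \<open>x\<close>. The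
  premise on \<open>g\<close> speaks of the remaining budget, which lets a proof fix the total cost
  \<open>C\<close> first.\<close>

lemma computes_bind:
  assumes f: "computes orc I f c"
    and g: "\<And>x. computes orc {i \<in> I. f i = x} g (\<lambda>i. C i - c i)"
  shows "computes orc I g C"
proof -
  obtain A where A: "\<forall>i\<in>I. result (orc i) A = f i \<and> real (query_count (orc i) A) \<le> c i"
    using f unfolding computes_def by blast
  have "\<forall>x. \<exists>B. \<forall>i\<in>{i \<in> I. f i = x}.
      result (orc i) B = g i \<and> real (query_count (orc i) B) \<le> C i - c i"
    using g unfolding computes_def by blast
  then obtain B where B: "\<And>x i. i \<in> I \<Longrightarrow> f i = x \<Longrightarrow>
      result (orc i) (B x) = g i \<and> real (query_count (orc i) (B x)) \<le> C i - c i"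
    by (metis (mono_tags, lifting) mem_Collect_eq)
  have "result (orc i) (bind_alg A B) = g i \<and> real (query_count (orc i) (bind_alg A B)) \<le> C i"
    if "i \<in> I" for i
    using A[rule_format, OF that] B[OF that refl] by auto
  then show ?thesis unfolding computes_def by blast
qed

lemma computes_pair:
  assumes f: "computes orc I f c" and g: "computes orc I g c'"
  shows "computes orc I (\<lambda>i. (f i, g i)) (\<lambda>i. c i + c' i)"
proof (rule computes_bind[OF f])
  fix x
  show "computes orc {i \<in> I. f i = x} (\<lambda>i. (f i, g i)) (\<lambda>i. c i + c' i - c i)"
  proof (rule computes_bind)
    show "computes orc {i \<in> I. f i = x} g c'"
      by (rule computes_mono[OF g]) auto
    show "computes orc {i \<in> {i \<in> I. f i = x}. g i = y} (\<lambda>i. (f i, g i)) (\<lambda>i. c i + c' i - c i - c' i)" for y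
      by (rule computes_const[where x = "(x, y)"]) auto
  qed
qed

text \<open>Only queries are charged, so postprocessing by \<open>h\<close> is free.\<close>

lemma computes_comp:
  assumes f: "computes orc I f c" and "\<And>i. i \<in> I \<Longrightarrow> g i = h (f i)"
  shows "computes orc I g c"
  by (rule computes_bind[OF f]) (auto intro!: computes_const[where x = "h _"] simp: assms)

lemma computes_Collect:
  assumes "finite S" and "\<And>x. x \<in> S \<Longrightarrow> computes orc I (\<lambda>i. Q i x) (\<lambda>_. 1)"
  shows "computes orc I (\<lambda>i. {x \<in> S. Q i x}) (\<lambda>_. real (card S))"
  using assms
proof (induction S rule: finite_induct)
  case empty
  then show ?case by (intro computes_const) auto
next
  case (insert x S)
  have "computes orc I (\<lambda>i. ({x \<in> S. Q i x}, Q i x)) (\<lambda>_. real (card S) + 1)"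
    using insert by (intro computes_pair) auto
  then show ?case
    using insert(1,2)
    by (intro computes_comp[where h = "\<lambda>(Y, b). if b then insert x Y else Y"]) (auto simp: add.commute split: if_splits)
qed

text \<open>A linear scan compares each new element with the current maximum. The selection
  \<open>f\<close> is existential because ties are resolved by the order of the scan.\<close>

lemma computes_greatest:
  assumes "finite S" "S \<noteq> {}"
    and "\<And>x y. x \<in> S \<Longrightarrow> y \<in> S \<Longrightarrow> computes orc I (\<lambda>i. Q i x y) (\<lambda>_. 1)"
    and "\<And>i x y. i \<in> I \<Longrightarrow> x \<in> S \<Longrightarrow> y \<in> S \<Longrightarrow> Q i x y \<or> Q i y x"
    and "\<And>i x y z. i \<in> I \<Longrightarrow> x \<in> S \<Longrightarrow> y \<in> S \<Longrightarrow> z \<in> S \<Longrightarrow> Q i x y \<Longrightarrow> Q i y z \<Longrightarrow> Q i x z"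
  shows "\<exists>f. computes orc I f (\<lambda>_. real (card S)) \<and> (\<forall>i\<in>I. f i \<in> S \<and> (\<forall>x\<in>S. Q i x (f i)))"
  using assms
proof (induction S rule: finite_ne_induct)
  case (singleton x)
  have "\<And>i. i \<in> I \<Longrightarrow> Q i x x" using singleton(2)[of _ x x] by simp
  then show ?case
    by (intro exI[of _ "\<lambda>_. x"] conjI computes_const) auto
next
  case (insert x S)
  obtain f where f: "computes orc I f (\<lambda>_. real (card S))"
    and f': "\<And>i. i \<in> I \<Longrightarrow> f i \<in> S \<and> (\<forall>x\<in>S. Q i x (f i))"
  proof -
    have "\<exists>f. computes orc I f (\<lambda>_. real (card S)) \<and> (\<forall>i\<in>I. f i \<in> S \<and> (\<forall>x\<in>S. Q i x (f i)))"
    proof (rule insert.IH)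
      show "computes orc I (\<lambda>i. Q i x y) (\<lambda>_. 1)" if "x \<in> S" "y \<in> S" for x y
        using insert.prems(1) that by blast
      show "Q i x y \<or> Q i y x" if "i \<in> I" "x \<in> S" "y \<in> S" for i x y
        using insert.prems(2) that by blast
      show "Q i x z" if "i \<in> I" "x \<in> S" "y \<in> S" "z \<in> S" "Q i x y" "Q i y z" for i x y z
        using insert.prems(3) that by blast
    qed
    then show thesis using that by blast
  qed
  define g where "g i = (if Q i x (f i) then f i else x)" for i
  have "computes orc I g (\<lambda>_. real (card (insert x S)))"
  proof (rule computes_bind[OF f])
    fix y
    let ?J = "{i \<in> I. f i = y}"
    show "computes orc ?J g (\<lambda>_. real (card (insert x S)) - real (card S))"
    proof (cases "y \<in> S")
      case True
      have "computes orc ?J (\<lambda>i. Q i x y) (\<lambda>_. 1)"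
        by (rule computes_mono[OF insert.prems(1)[of x y]]) (use True in auto)
      then show ?thesis
        using insert(1,3)
        by (intro computes_comp[where h = "\<lambda>b. if b then y else x"]) (auto simp: g_def)
    next
      case False
      \<comment> \<open>\<open>f\<close> takes its values in \<open>S\<close>, so \<open>?J\<close>
        is empty and any constant serves as output.\<close>
      then show ?thesis using f' by (intro computes_const[where x = undefined]) auto
    qed
  qed
  moreover have "g i \<in> insert x S \<and> (\<forall>z\<in>insert x S. Q i z (g i))" if "i \<in> I" for i
  proof -
    have fi: "f i \<in> S" "\<And>z. z \<in> S \<Longrightarrow> Q i z (f i)" using f'[OF that] by auto
    show ?thesis
    proof (cases "Q i x (f i)")
      case True
      then show ?thesis using fi by (simp add: g_def)
    next
      case False
      then have "Q i (f i) x" "Q i x x" using fi insert.prems(2)[OF that] by blast+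
      then show ?thesis
        using False fi insert.prems(3)[OF that, of _ "f i" x] by (auto simp: g_def)
    qed
  qed
  ultimately show ?case by blast
qed

text \<open>The set to scan depends on the instance: it is determined first, and the scan then runs
  on each class with a constant value of \<open>A\<close>. Totality is asked on \<open>A i\<close>
  only, because the intended sets are chains of ancestors in an order that is not total on
  \<open>X\<close> in general.\<close>

lemma computes_greatest_of:
  assumes A: "computes orc I A (\<lambda>_. c)" and X: "finite X"
    and sub: "\<And>i. i \<in> I \<Longrightarrow> A i \<subseteq> X" "\<And>i. i \<in> I \<Longrightarrow> A i \<noteq> {}"
    and Q: "\<And>x y. x \<in> X \<Longrightarrow> y \<in> X \<Longrightarrow> computes orc I (\<lambda>i. Q i x y) (\<lambda>_. 1)"
    and total: "\<And>i x y. i \<in> I \<Longrightarrow> x \<in> A i \<Longrightarrow> y \<in> A i \<Longrightarrow> Q i x y \<or> Q i y x"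
    and trans: "\<And>i x y z. i \<in> I \<Longrightarrow> x \<in> A i \<Longrightarrow> y \<in> A i \<Longrightarrow> z \<in> A i \<Longrightarrow>
      Q i x y \<Longrightarrow> Q i y z \<Longrightarrow> Q i x z"
  shows "\<exists>f. computes orc I f (\<lambda>_. c + real (card X)) \<and>
    (\<forall>i\<in>I. f i \<in> A i \<and> (\<forall>x\<in>A i. Q i x (f i)))"
proof -
  have "\<exists>f. computes orc {i \<in> I. A i = S} f (\<lambda>_. real (card X)) \<and>
      (\<forall>i\<in>{i \<in> I. A i = S}. f i \<in> S \<and> (\<forall>x\<in>S. Q i x (f i)))" for S
  proof (cases "{i \<in> I. A i = S} = {}")
    case True
    then show ?thesis
      unfolding True by (intro exI[of _ undefined] conjI computes_const) auto
  next
    case False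
    then have S: "S \<subseteq> X" "S \<noteq> {}" using sub by auto
    have "\<exists>f. computes orc {i \<in> I. A i = S} f (\<lambda>_. real (card S)) \<and>
        (\<forall>i\<in>{i \<in> I. A i = S}. f i \<in> S \<and> (\<forall>x\<in>S. Q i x (f i)))"
    proof (rule computes_greatest)
      show "finite S" using S X finite_subset by blast
      show "computes orc {i \<in> I. A i = S} (\<lambda>i. Q i x y) (\<lambda>_. 1)" if "x \<in> S" "y \<in> S" for x y
        by (rule computes_mono[OF Q]) (use S that in auto)
    qed (use S total trans in blast)+
    then obtain f where "computes orc {i \<in> I. A i = S} f (\<lambda>_. real (card S))"
      "\<forall>i\<in>{i \<in> I. A i = S}. f i \<in> S \<and> (\<forall>x\<in>S. Q i x (f i))" by blast
    moreover from this(1) have "computes orc {i \<in> I. A i = S} f (\<lambda>_. real (card X))"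
      by (rule computes_mono) (use card_mono[OF X S(1)] in auto)
    ultimately show ?thesis by blast
  qed
  then obtain g where g: "\<And>S. computes orc {i \<in> I. A i = S} (g S) (\<lambda>_. real (card X))"
    "\<And>S i. i \<in> I \<Longrightarrow> A i = S \<Longrightarrow> g S i \<in> S \<and> (\<forall>x\<in>S. Q i x (g S i))"
    by (simp only: mem_Collect_eq Ball_def) metis
  have "computes orc I (\<lambda>i. g (A i) i) (\<lambda>_. c + real (card X))"
    by (rule computes_bind[OF A], rule computes_mono[OF g(1)]) auto
  then show ?thesis using g(2) by (intro exI[of _ "\<lambda>i. g (A i) i"]) auto
qed

section \<open>Tree orders\<close>

definition covers :: "'v set \<Rightarrow> ('v \<Rightarrow> 'v \<Rightarrow> bool) \<Rightarrow> 'v \<Rightarrow> 'v \<Rightarrow> bool" where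
  "covers V R u v \<longleftrightarrow>
     u \<in> V \<and> v \<in> V \<and> u \<noteq> v \<and> R u v \<and> (\<forall>z\<in>V. R u z \<longrightarrow> R z v \<longrightarrow> z = u \<or> z = v)"

text \<open>\<open>R a b\<close> reads as \<open>a\<close> being an ancestor of \<open>b\<close>.
  The fourth condition makes the ancestors of a vertex a chain, and the last one bounds the number
  of children.\<close>

definition tree_order :: "'v set \<Rightarrow> ('v \<Rightarrow> 'v \<Rightarrow> bool) \<Rightarrow> nat \<Rightarrow> bool" where
  "tree_order V R d \<longleftrightarrow>
     (\<forall>a\<in>V. R a a) \<and> (\<forall>a\<in>V. \<forall>b\<in>V. \<forall>c\<in>V. R a b \<longrightarrow> R b c \<longrightarrow> R a c) \<and>
     (\<forall>a\<in>V. \<forall>b\<in>V. R a b \<longrightarrow> R b a \<longrightarrow> a = b) \<and>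
     (\<forall>a\<in>V. \<forall>b\<in>V. \<forall>c\<in>V. R a c \<longrightarrow> R b c \<longrightarrow> R a b \<or> R b a) \<and>
     (\<forall>a\<in>V. card {b. covers V R a b} \<le> d)"

text \<open>A connected piece of the tree with top vertex \<open>w\<close>. Connectivity is
  expressed as convexity, since the tree path from \<open>w\<close> down to a vertex consists of the
  vertices between them in the order.\<close>

definition component :: "'v set \<Rightarrow> ('v \<Rightarrow> 'v \<Rightarrow> bool) \<Rightarrow> 'v set \<Rightarrow> 'v \<Rightarrow> bool" where
  "component V R X w \<longleftrightarrow>
     X \<subseteq> V \<and> w \<in> X \<and> (\<forall>x\<in>X. R w x) \<and> (\<forall>x\<in>X. \<forall>y\<in>V. R w y \<longrightarrow> R y x \<longrightarrow> y \<in> X)"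

definition below :: "('v \<Rightarrow> 'v \<Rightarrow> bool) \<Rightarrow> 'v set \<Rightarrow> 'v \<Rightarrow> 'v set" where
  "below R X b = {x \<in> X. R b x}"

definition cover_pairs :: "'v set \<Rightarrow> ('v \<Rightarrow> 'v \<Rightarrow> bool) \<Rightarrow> 'v set \<Rightarrow> ('v \<times> 'v) set" where
  "cover_pairs V R X = {(u, v). u \<in> X \<and> v \<in> X \<and> covers V R u v}"

definition children :: "'v set \<Rightarrow> ('v \<Rightarrow> 'v \<Rightarrow> bool) \<Rightarrow> 'v set \<Rightarrow> 'v \<Rightarrow> 'v set" where
  "children V R X w = {c \<in> X. covers V R w c}"

lemma tree_orderD:
  assumes "tree_order V R d"
  shows "a \<in> V \<Longrightarrow> R a a"
    and "a \<in> V \<Longrightarrow> b \<in> V \<Longrightarrow> c \<in> V \<Longrightarrow> R a b \<Longrightarrow> R b c \<Longrightarrow> R a c"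
    and "a \<in> V \<Longrightarrow> b \<in> V \<Longrightarrow> R a b \<Longrightarrow> R b a \<Longrightarrow> a = b"
    and "a \<in> V \<Longrightarrow> b \<in> V \<Longrightarrow> c \<in> V \<Longrightarrow> R a c \<Longrightarrow> R b c \<Longrightarrow> R a b \<or> R b a"
    and "a \<in> V \<Longrightarrow> card {b. covers V R a b} \<le> d"
  using assms unfolding tree_order_def by meson+

lemma componentD:
  assumes "component V R X w"
  shows "X \<subseteq> V" "w \<in> X" "w \<in> V" "x \<in> X \<Longrightarrow> R w x"
  using assms unfolding component_def by blast+

lemma component_convex:
  "component V R X w \<Longrightarrow> x \<in> X \<Longrightarrow> y \<in> V \<Longrightarrow> R w y \<Longrightarrow> R y x \<Longrightarrow> y \<in> X"
  unfolding component_def by blast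

lemma below_subset: "below R X b \<subseteq> X"
  by (auto simp: below_def)

lemma component_below:
  assumes t: "tree_order V R d" and X: "component V R X w" "b \<in> X"
  shows "component V R (below R X b) b"
  unfolding component_def
proof (intro conjI ballI impI)
  have sub: "X \<subseteq> V" "w \<in> V" "R w b" using componentD[OF X(1)] X(2) by auto
  have bV: "b \<in> V" "R b b" using tree_orderD(1)[OF t] X sub by auto
  then show "below R X b \<subseteq> V" "b \<in> below R X b"
    using X sub by (auto simp: below_def)
  fix x assume x: "x \<in> below R X b"
  then show "R b x" by (simp add: below_def)
  fix y assume y: "y \<in> V" "R b y" "R y x"
  have "R w y" using tree_orderD(2)[OF t] sub bV y by blast
  then have "y \<in> X" using component_convex[OF X(1) _ y(1) _ y(3)] x by (simp add: below_def)
  then show "y \<in> below R X b" using y by (simp add: below_def)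
qed

lemma component_diff_below:
  assumes t: "tree_order V R d" and X: "component V R X w" "b \<in> X" "b \<noteq> w"
  shows "component V R (X - below R X b) w"
  unfolding component_def
proof (intro conjI ballI impI)
  have sub: "X \<subseteq> V" "w \<in> X" "R w b" using componentD[OF X(1)] X(2) by auto
  show "X - below R X b \<subseteq> V" using sub by blast
  have "\<not> R b w" using tree_orderD(3)[OF t, of b w] X sub by blast
  then show "w \<in> X - below R X b" using sub by (simp add: below_def)
  fix x assume x: "x \<in> X - below R X b"
  then show "R w x" using componentD[OF X(1)] by blast
  fix y assume y: "y \<in> V" "R w y" "R y x"
  then have "y \<in> X" using component_convex[OF X(1)] x by blast
  moreover have "\<not> R b y" using tree_orderD(2)[OF t, of b y x] X sub x y by (auto simp: below_def)
  ultimately show "y \<in> X - below R X b" by (simp add: below_def)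
qed

text \<open>A vertex between \<open>p\<close> and \<open>b\<close> lies in \<open>X\<close> by
  convexity; if it is not \<open>b\<close>, it is one of the proper ancestors compared with
  \<open>p\<close>, hence equal to \<open>p\<close>. So parents can be found by maximization inside
  \<open>X\<close>.\<close>

lemma greatest_proper_ancestor_covers:
  assumes "tree_order V R d" "component V R X w" "b \<in> X"
    and "p \<in> X" "R p b" "p \<noteq> b" and "\<And>x. x \<in> X \<Longrightarrow> R x b \<Longrightarrow> x \<noteq> b \<Longrightarrow> R x p"
  shows "covers V R p b"
  unfolding covers_def
proof (intro conjI ballI impI)
  fix z assume z: "z \<in> V" "R p z" "R z b"
  have sub: "X \<subseteq> V" "R w p" "w \<in> X" using componentD[OF assms(2)] assms(4) by blast+
  then have "R w z" using tree_orderD(2)[OF assms(1), of w p z] assms(4) z by blast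
  then have "z \<in> X" using component_convex[OF assms(2,3) z(1) _ z(3)] by blast
  then show "z = p \<or> z = b"
    using tree_orderD(3)[OF assms(1), of z p] assms(4,7) z sub by blast
qed (use componentD(1)[OF assms(2)] assms(3-6) in \<open>blast+\<close>)

text \<open>Only one covering pair crosses the cut. If \<open>v\<close> is below \<open>b\<close>
  and \<open>u\<close> is not, then \<open>u\<close> and \<open>b\<close> are comparable as
  ancestors of \<open>v\<close>, so \<open>b\<close> lies between \<open>u\<close> and
  \<open>v\<close> and covering forces \<open>v = b\<close>, and then \<open>u = p\<close>. By
  transitivity no pair leaves the part below \<open>b\<close>.\<close>

lemma cover_pairs_cut:
  assumes t: "tree_order V R d" and X: "X \<subseteq> V" "b \<in> X" "p \<in> X" and p: "covers V R p b"
  shows "cover_pairs V R X =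
    insert (p, b) (cover_pairs V R (below R X b) \<union> cover_pairs V R (X - below R X b))"
proof -
  have enter: "u = p \<and> v = b"
    if uv: "covers V R u v" "u \<in> X" "v \<in> X" "\<not> R b u" "R b v" for u v
  proof -
    have "R u b" using tree_orderD(4)[OF t, of u b v] uv X by (auto simp: covers_def)
    then have "v = b" using uv X unfolding covers_def by (metis subsetD)
    moreover have "R u p \<or> R p u" using tree_orderD(4)[OF t, of u p b] uv X p \<open>R u b\<close> by (auto simp: covers_def)
    then have "u = p" using uv p \<open>v = b\<close> unfolding covers_def by metis
    ultimately show ?thesis by simp
  qed
  have stay: "R b v" if "covers V R u v" "u \<in> X" "v \<in> X" "R b u" for u v
    using tree_orderD(2)[OF t, of b u v] that X by (auto simp: covers_def)
  have "(u, v) \<in> cover_pairs V R X \<longleftrightarrow> (u, v) = (p, b) \<or>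
      (u, v) \<in> cover_pairs V R (below R X b) \<or> (u, v) \<in> cover_pairs V R (X - below R X b)" for u v
    unfolding cover_pairs_def below_def using enter[of u v] stay[of u v] X p by blast
  then show ?thesis by auto
qed

lemma cover_pairs_singleton [simp]: "cover_pairs V R {w} = {}"
  by (auto simp: cover_pairs_def covers_def)

section \<open>The ancestor order of a rooted tree\<close>

text \<open>The dominator relation of flow graphs with entry \<open>r\<close>. In a tree it is the
  ancestor order, and this form matches \<open>sep\<close> without any appeal to unique simple
  paths.\<close>

definition dominates :: "'v set \<Rightarrow> 'v set set \<Rightarrow> 'v \<Rightarrow> 'v \<Rightarrow> 'v \<Rightarrow> bool" where
  "dominates V E r b c \<longleftrightarrow> (\<forall>p. walk V E r p c \<longrightarrow> b \<in> set p)"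

section \<open>Extending, reversing and shortening walks\<close>

lemma walk_append_edge:
  assumes "walk V E a p x" "{x, y} \<in> E" "y \<in> V"
  shows "walk V E a (p @ [y]) y"
  using assms by (auto simp: walk_def successively_append_iff)

lemma walk_append_tl:
  assumes "walk V E a p x" "walk V E x q y"
  shows "walk V E a (p @ tl q) y"
proof (cases q)
  case Nil
  then show ?thesis using assms by (simp add: walk_def)
next
  case (Cons z q')
  then show ?thesis using assms
    by (cases q') (auto simp: walk_def successively_append_iff)
qed

lemma walk_rev:
  assumes "walk V E a p b"
  shows "walk V E b (rev p) a"
  using assms by (auto simp: walk_def hd_rev last_rev insert_commute)

text \<open>Cut \<open>p\<close> at an occurrence of \<open>x\<close>. If \<open>p\<close> repeats
  no vertex, its end \<open>b\<close> comes after \<open>x\<close>, so the prefix misses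
  \<open>b\<close>; this makes domination antisymmetric.\<close>

lemma walk_prefix:
  assumes "walk V E a p b" "x \<in> set p"
  obtains q where "walk V E a q x" "set q \<subseteq> set p"
    "x \<noteq> b \<Longrightarrow> distinct p \<Longrightarrow> b \<notin> set q"
proof -
  obtain ys zs where p: "p = ys @ x # zs" using assms(2) by (meson split_list)
  have "successively (\<lambda>x y. {x, y} \<in> E) ((ys @ [x]) @ zs)"
    using assms(1) by (simp add: walk_def p)
  then have "successively (\<lambda>x y. {x, y} \<in> E) (ys @ [x])"
    unfolding successively_append_iff[of _ "ys @ [x]"] by simp
  then have "walk V E a (ys @ [x]) x"
    using assms(1) by (cases ys) (auto simp: walk_def p)
  moreover have "b \<notin> set (ys @ [x])" if "x \<noteq> b" "distinct p"
  proof -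
    have "b \<in> set zs" using assms(1) that by (auto simp: walk_def p split: if_splits)
    then show ?thesis using that by (auto simp: p)
  qed
  ultimately show ?thesis by (intro that[of "ys @ [x]"]) (auto simp: p)
qed

lemma walk_distinct:
  assumes "walk V E a p b"
  obtains q where "walk V E a q b" "distinct q"
  using assms
proof (induction "length p" arbitrary: p thesis rule: less_induct)
  case less
  show ?case
  proof (cases "distinct p")
    case True
    then show ?thesis using less by blast
  next
    case False
    then obtain xs ys zs x where p: "p = xs @ [x] @ ys @ [x] @ zs"
      using not_distinct_decomp by blast
    let ?q = "xs @ [x] @ zs"
    have "walk V E a ?q b"
      using less.prems(2)
      by (cases xs) (auto simp: walk_def p successively_append_iff successively_Cons hd_append split: if_splits)
    then show ?thesis
      using less.hyps[of ?q] less.prems(1) by (auto simp: p)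
  qed
qed

lemma walk_drop_vertex:
  "walk (V - {b}) {e \<in> E. b \<notin> e} a p c \<longleftrightarrow> walk V E a p c \<and> b \<notin> set p"
proof -
  have "successively (\<lambda>x y. {x, y} \<in> E \<and> b \<noteq> x \<and> b \<noteq> y) p \<longleftrightarrow> successively (\<lambda>x y. {x, y} \<in> E) p"
    if "b \<notin> set p"
    using that by (induction p rule: induct_list012) auto
  then show ?thesis by (auto simp: walk_def subset_Diff_insert)
qed

text \<open>One query decides an ancestor test. The two end points lie on every walk but get answer
  0 from \<open>sep\<close>, hence the two extra disjuncts, which need no query.\<close>

lemma dominates_iff_sep:
  assumes "r \<in> V" "b \<in> V" "c \<in> V"
  shows "dominates V E r b c \<longleftrightarrow> b = r \<or> b = c \<or> sep V E r b c"
proof -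
  have "r \<in> set p" "c \<in> set p" if "walk V E r p c" for p
    using that by (auto simp: walk_def)
  then show ?thesis
    using assms by (auto simp: dominates_def sep_def joined_def walk_drop_vertex)
qed

section \<open>Domination in a tree with a fixed root\<close>

context
  fixes V :: "'v set" and E r
  assumes tree: "is_tree V E" and r: "r \<in> V"
begin

lemma edge_vertices: "{u, v} \<in> E \<Longrightarrow> u \<in> V \<and> v \<in> V \<and> u \<noteq> v"
  using tree unfolding is_tree_def simple_graph_def by (metis doubleton_eq_iff insert_absorb2)

lemma joined_root: "v \<in> V \<Longrightarrow> \<exists>p. walk V E r p v"
  using tree r unfolding is_tree_def joined_def by blast

lemma dominates_refl: "dominates V E r a a"
  by (auto simp: dominates_def walk_def)

lemma dominates_trans: "dominates V E r a b \<Longrightarrow> dominates V E r b c \<Longrightarrow> dominates V E r a c"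
  unfolding dominates_def by (meson subsetD walk_prefix)

lemma dominates_antisym:
  assumes "a \<in> V" "b \<in> V" "dominates V E r a b" "dominates V E r b a"
  shows "a = b"
proof (rule ccontr)
  assume "a \<noteq> b"
  obtain p where "walk V E r p b" using joined_root assms by blast
  then obtain p where p: "walk V E r p b" "distinct p" by (metis walk_distinct)
  then have "a \<in> set p" using assms by (auto simp: dominates_def)
  then obtain q where "walk V E r q a" "b \<notin> set q" using p walk_prefix \<open>a \<noteq> b\<close> by metis
  then show False using assms by (auto simp: dominates_def)
qed

text \<open>Otherwise some walk reaches each of \<open>a\<close>, \<open>b\<close> while avoiding
  the other. On a walk to \<open>c\<close>, take the last vertex that is \<open>a\<close> or
  \<open>b\<close>, and reach it by the walk avoiding the other one: the result leads to
  \<open>c\<close> and misses a dominator of \<open>c\<close>.\<close>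

lemma dominates_chain:
  assumes "a \<in> V" "b \<in> V" "c \<in> V" "dominates V E r a c" "dominates V E r b c"
  shows "dominates V E r a b \<or> dominates V E r b a"
proof (rule ccontr)
  assume "\<not> ?thesis"
  then obtain p q where p: "walk V E r p b" "a \<notin> set p" and q: "walk V E r q a" "b \<notin> set q"
    by (auto simp: dominates_def)
  obtain w where w: "walk V E r w c" using joined_root assms by blast
  have "a \<in> set w" "b \<in> set w" "a \<noteq> b"
    using w assms q by (auto simp: dominates_def walk_def)
  then obtain ys zs x where w': "w = ys @ x # zs" "x = a \<or> x = b" "a \<notin> set zs" "b \<notin> set zs"
    using split_list_last_prop[of w "\<lambda>x. x = a \<or> x = b"] by auto
  have tail: "walk V E x (x # zs) c"
    using w by (auto simp: walk_def w' successively_append_iff)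
  show False
  proof (cases "x = a")
    case True
    then have "walk V E r (q @ zs) c" using walk_append_tl[of V E r q x "x # zs" c] q tail by simp
    then have "b \<in> set (q @ zs)" using assms(5) unfolding dominates_def by blast
    then show False using q w' by simp
  next
    case False
    then have "walk V E r (p @ zs) c" using walk_append_tl[of V E r p x "x # zs" c] p tail w' by simp
    then have "a \<in> set (p @ zs)" using assms(4) unfolding dominates_def by blast
    then show False using p w' by simp
  qed
qed

text \<open>Otherwise a walk to \<open>u\<close> that avoids \<open>v\<close> and one to \<open>v\<close> that avoids \<open>u\<close> would connect
  the two end points without using the edge, which would close a cycle.\<close>

lemma edge_dominates:
  assumes "{u, v} \<in> E"
  shows "dominates V E r u v \<or> dominates V E r v u"
proof (rule ccontr)
  assume "\<not> ?thesis"
  then obtain p q where p: "walk V E r p v" "u \<notin> set p" and q: "walk V E r q u" "v \<notin> set q"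
    by (auto simp: dominates_def)
  let ?E = "E - {{u, v}}"
  have del: "walk V ?E a w b" if "walk V E a w b" "u \<notin> set w \<or> v \<notin> set w" for a w b
  proof -
    have "successively (\<lambda>x y. {x, y} \<in> ?E) w" if "successively (\<lambda>x y. {x, y} \<in> E) w"
      using that \<open>u \<notin> set w \<or> v \<notin> set w\<close>
      by (induction w rule: induct_list012) (auto simp: doubleton_eq_iff)
    then show ?thesis using that by (auto simp: walk_def)
  qed
  have "walk V ?E u (rev q @ tl p) v"
    using p q by (intro walk_append_tl walk_rev del) auto
  then obtain w where w: "walk V ?E u w v" "distinct w" by (metis walk_distinct)
  have uv: "u \<noteq> v" using edge_vertices assms by blast
  \<comment> \<open>A shorter walk between the distinct vertices \<open>u\<close> and
    \<open>v\<close> would be the deleted edge itself.\<close>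
  have "3 \<le> length w"
  proof (rule ccontr)
    assume "\<not> 3 \<le> length w"
    then have "length w = 0 \<or> length w = 1 \<or> length w = 2" by linarith
    then show False using w uv
      by (auto simp: walk_def length_Suc_conv numeral_2_eq_2)
  qed
  moreover have "successively (\<lambda>x y. {x, y} \<in> E) w"
    using w by (auto simp: walk_def intro: successively_mono)
  ultimately have "graph_cycle V E w"
    using w assms by (auto simp: graph_cycle_def walk_def insert_commute)
  then show False using tree by (auto simp: is_tree_def)
qed

text \<open>Every walk to \<open>u\<close> extends by the edge to a walk to \<open>v\<close>. A
  dominator \<open>z\<close> of \<open>v\<close> other than \<open>v\<close> therefore already lies
  on the walk to \<open>u\<close>, so it dominates \<open>u\<close>, and antisymmetry
  applies.\<close>

lemma edge_covers:
  assumes "{u, v} \<in> E" "dominates V E r u v"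
  shows "covers V (dominates V E r) u v"
  unfolding covers_def
proof (intro conjI ballI impI)
  fix z assume z: "z \<in> V" "dominates V E r u z" "dominates V E r z v"
  have "dominates V E r z u" if "z \<noteq> v"
    using z(3) walk_append_edge[OF _ assms(1)] edge_vertices[OF assms(1)] that
    by (fastforce simp: dominates_def)
  then show "z = u \<or> z = v" using z dominates_antisym edge_vertices[OF assms(1)] by blast
qed (use assms edge_vertices[OF assms(1)] in simp_all)

text \<open>Let \<open>x\<close> be the last vertex but one on a simple walk from \<open>r\<close>
  to \<open>v\<close>. As \<open>v\<close> does not dominate \<open>x\<close>, the edge forces
  \<open>x\<close> to dominate \<open>v\<close>; moreover \<open>u\<close> dominates
  \<open>x\<close>, since walks to \<open>x\<close> extend to \<open>v\<close>. Covering then gives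
  \<open>x = u\<close>.\<close>

lemma covers_edge:
  assumes "covers V (dominates V E r) u v"
  shows "{u, v} \<in> E"
proof -
  have uv: "u \<in> V" "v \<in> V" "u \<noteq> v" "dominates V E r u v"
    using assms by (auto simp: covers_def)
  obtain p where "walk V E r p v" using joined_root uv by blast
  then obtain p where p: "walk V E r p v" "distinct p" by (metis walk_distinct)
  have "u \<in> set p" using uv p by (auto simp: dominates_def)
  have "butlast p \<noteq> []"
  proof
    assume "butlast p = []"
    then have "p = [v]" using p append_butlast_last_id[of p] by (auto simp: walk_def)
    then show False using \<open>u \<in> set p\<close> uv by simp
  qed
  then obtain q x where "butlast p = q @ [x]" by (metis rev_exhaust)
  then have pq: "p = (q @ [x]) @ [v]"
    using p append_butlast_last_id[of p] by (auto simp: walk_def)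
  have s: "successively (\<lambda>x y. {x, y} \<in> E) ((q @ [x]) @ [v])" using p pq by (simp add: walk_def)
  then have e: "{x, v} \<in> E" and s': "successively (\<lambda>x y. {x, y} \<in> E) (q @ [x])"
    unfolding successively_append_iff[of _ "q @ [x]"] by auto
  have q: "walk V E r (q @ [x]) x"
    using p s' by (cases q) (auto simp: walk_def pq)
  have xv: "x \<in> V" "x \<noteq> v" using edge_vertices e by auto
  have "\<not> dominates V E r v x" using q p by (auto simp: dominates_def pq)
  then have x: "dominates V E r x v" using edge_dominates e by blast
  have "dominates V E r u x"
    using uv(3,4) walk_append_edge[OF _ e] uv(2) by (fastforce simp: dominates_def)
  then have "x = u" using assms x xv by (auto simp: covers_def)
  then show ?thesis using e by simp
qed

lemma edges_eq_covers:
  "E = (\<lambda>(u, v). {u, v}) ` cover_pairs V (dominates V E r) V"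
proof (intro equalityI subsetI)
  fix e assume "e \<in> E"
  then obtain u v where e: "e = {u, v}" "u \<in> V" "v \<in> V"
    using tree unfolding is_tree_def simple_graph_def by blast
  then have "covers V (dominates V E r) u v \<or> covers V (dominates V E r) v u"
    using edge_dominates edge_covers \<open>e \<in> E\<close> by (metis insert_commute)
  then show "e \<in> (\<lambda>(u, v). {u, v}) ` cover_pairs V (dominates V E r) V"
    using e by (force simp: cover_pairs_def insert_commute)
qed (auto simp: cover_pairs_def dest: covers_edge)

lemma finite_edges: "finite E"
proof -
  have "E \<subseteq> Pow V" "finite V" using tree by (auto simp: is_tree_def simple_graph_def)
  then show ?thesis by (meson finite_Pow_iff finite_subset)
qed

lemma tree_order_dominates:
  assumes "max_degree V E \<le> d"
  shows "tree_order V (dominates V E r) d"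
proof -
  have "card {v. covers V (dominates V E r) u v} \<le> d" if "u \<in> V" for u
  proof -
    have "card {v. covers V (dominates V E r) u v} \<le> card {e \<in> E. u \<in> e}"
      using finite_edges
      by (intro card_inj_on_le[of "\<lambda>v. {u, v}"]) (auto simp: inj_on_def doubleton_eq_iff dest: covers_edge)
    also have "\<dots> \<le> max_degree V E"
      using that tree unfolding max_degree_def vertex_degree_def
      by (intro Max_ge) (auto simp: is_tree_def simple_graph_def)
    finally show ?thesis using assms by simp
  qed
  then have "\<forall>u\<in>V. card {v. covers V (dominates V E r) u v} \<le> d"
    by blast
  moreover have "\<forall>a\<in>V. dominates V E r a a"
    by (simp add: dominates_refl)
  moreover have "\<forall>a\<in>V. \<forall>b\<in>V. \<forall>c\<in>V. dominates V E r a b \<longrightarrow> dominates V E r b c \<longrightarrow> dominates V E r a c"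
    by (intro ballI impI) (rule dominates_trans)
  moreover have "\<forall>a\<in>V. \<forall>b\<in>V. dominates V E r a b \<longrightarrow> dominates V E r b a \<longrightarrow> a = b"
    by (intro ballI impI) (rule dominates_antisym)
  moreover have "\<forall>a\<in>V. \<forall>b\<in>V. \<forall>c\<in>V. dominates V E r a c \<longrightarrow> dominates V E r b c \<longrightarrow>
      dominates V E r a b \<or> dominates V E r b a"
    by (intro ballI impI) (rule dominates_chain)
  ultimately show ?thesis
    unfolding tree_order_def by (intro conjI)
qed

lemma component_dominates: "component V (dominates V E r) V r"
  using r by (auto simp: component_def dominates_def walk_def)

lemma shortest_walk:
  assumes "a \<in> V" "b \<in> V"
  obtains p where "walk V E a p b" "length p = Suc (graph_dist V E a b)"
proof -
  obtain p where "walk V E a p b" using tree assms unfolding is_tree_def joined_def by blast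
  then have "\<exists>k p. walk V E a p b \<and> length p = Suc k"
    by (metis length_0_conv not0_implies_Suc walk_def)
  from LeastI_ex[OF this] show ?thesis using that unfolding graph_dist_def by blast
qed

text \<open>The vertex \<open>z\<close> witnessing the height need not be the chosen root
  \<open>r\<close>. The walk from \<open>r\<close> through \<open>z\<close> to \<open>v\<close> has
  at most \<open>2 * h + 1\<close> vertices and contains every dominator of
  \<open>v\<close>.\<close>

lemma card_dominators:
  assumes "has_height V E h" "v \<in> V"
  shows "card {u \<in> V. dominates V E r u v} \<le> 2 * h + 1"
proof -
  obtain z where z: "z \<in> V" "\<And>x. x \<in> V \<Longrightarrow> graph_dist V E z x \<le> h"
    using assms by (auto simp: has_height_def)
  obtain p where p: "walk V E z p r" "length p = Suc (graph_dist V E z r)"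
    using shortest_walk z r by blast
  obtain q where q: "walk V E z q v" "length q = Suc (graph_dist V E z v)"
    using shortest_walk z assms by blast
  have "walk V E r (rev p @ tl q) v" using p q by (intro walk_append_tl walk_rev)
  then have "{u \<in> V. dominates V E r u v} \<subseteq> set (rev p @ tl q)"
    unfolding dominates_def by blast
  then have "card {u \<in> V. dominates V E r u v} \<le> card (set (rev p @ tl q))"
    by (intro card_mono) auto
  also have "\<dots> \<le> length (rev p @ tl q)" by (rule card_length)
  also have "\<dots> \<le> 2 * h + 1" using p q z(2)[OF r] z(2)[OF assms(2)] by simp
  finally show ?thesis .
qed

end

section \<open>Cutting a tree order\<close>

locale ancestor_queries =
  fixes V :: "'v set" and Is :: "'i set" and orc :: "'i \<Rightarrow> 'v \<Rightarrow> 'v \<Rightarrow> 'v \<Rightarrow> bool"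
    and R :: "'i \<Rightarrow> 'v \<Rightarrow> 'v \<Rightarrow> bool" and d :: nat
  assumes finite_V: "finite V"
    and tree: "i \<in> Is \<Longrightarrow> tree_order V (R i) d"
    and query: "a \<in> V \<Longrightarrow> b \<in> V \<Longrightarrow> computes orc Is (\<lambda>i. R i a b) (\<lambda>_. 1)"
begin

abbreviation "CP X i \<equiv> cover_pairs V (R i) X"

lemma query_mono: "I \<subseteq> Is \<Longrightarrow> a \<in> V \<Longrightarrow> b \<in> V \<Longrightarrow> computes orc I (\<lambda>i. R i a b) (\<lambda>_. 1)"
  by (rule computes_mono[OF query]) auto

text \<open>\<open>X\<close> and \<open>w\<close> are the same for all instances in
  \<open>I\<close>, so they are known to the algorithm; \<open>I\<close> shrinks as answers
  arrive.\<close>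

definition part :: "'i set \<Rightarrow> 'v set \<Rightarrow> 'v \<Rightarrow> bool" where
  "part I X w \<longleftrightarrow> I \<subseteq> Is \<and> (\<forall>i\<in>I. component V (R i) X w) \<and> finite X \<and> X \<subseteq> V \<and> w \<in> X"

lemma partD:
  assumes "part I X w"
  shows "I \<subseteq> Is" "i \<in> I \<Longrightarrow> component V (R i) X w" "i \<in> I \<Longrightarrow> tree_order V (R i) d"
    "finite X" "X \<subseteq> V" "w \<in> X" "w \<in> V"
  using assms tree unfolding part_def by auto

lemma part_subset: "part I X w \<Longrightarrow> J \<subseteq> I \<Longrightarrow> part J X w"
  unfolding part_def by blast

text \<open>The proper ancestors of \<open>b\<close> in \<open>X\<close> form a chain containing
  \<open>w\<close>. One round of tests finds this chain, a second one its greatest element, which is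
  the parent.\<close>

lemma computes_parent:
  assumes p: "part I X w" and b: "b \<in> X" "b \<noteq> w"
  shows "\<exists>f. computes orc I f (\<lambda>_. 2 * real (card X)) \<and>
    (\<forall>i\<in>I. f i \<in> X \<and> covers V (R i) (f i) b)"
proof -
  note X = partD[OF p]
  let ?A = "\<lambda>i. {x \<in> X - {b}. R i x b}"
  have "computes orc I ?A (\<lambda>_. real (card (X - {b})))"
    using X b by (intro computes_Collect query_mono) auto
  then have A: "computes orc I ?A (\<lambda>_. real (card X))"
    by (rule computes_mono) (use X in \<open>auto intro: card_mono\<close>)
  have "\<exists>f. computes orc I f (\<lambda>_. real (card X) + real (card X)) \<and>
      (\<forall>i\<in>I. f i \<in> ?A i \<and> (\<forall>x\<in>?A i. R i x (f i)))"
  proof (rule computes_greatest_of[OF A])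
    fix i assume i: "i \<in> I"
    show "?A i \<noteq> {}" using componentD(4)[OF X(2)[OF i]] X(6) b by auto
    fix x y assume x: "x \<in> ?A i" "y \<in> ?A i"
    show "R i x y \<or> R i y x" using tree_orderD(4)[OF X(3)[OF i], of x y b] x X(5) b by blast
    fix z assume "z \<in> ?A i" "R i x y" "R i y z"
    then show "R i x z" using tree_orderD(2)[OF X(3)[OF i], of x y z] x X(5) by blast
  next
    show "computes orc I (\<lambda>i. R i x y) (\<lambda>_. 1)" if "x \<in> X" "y \<in> X" for x y
      using X that by (intro query_mono) auto
  qed (use X in auto)
  then obtain f where f: "computes orc I f (\<lambda>_. real (card X) + real (card X))"
    "\<And>i. i \<in> I \<Longrightarrow> f i \<in> ?A i" "\<And>i x. i \<in> I \<Longrightarrow> x \<in> ?A i \<Longrightarrow> R i x (f i)" by blast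
  have "f i \<in> X \<and> covers V (R i) (f i) b" if "i \<in> I" for i
    using greatest_proper_ancestor_covers[OF X(3)[OF that] X(2)[OF that] b(1), of "f i"]
      f(2)[OF that] f(3)[OF that] by auto
  then show ?thesis using f(1) by (intro exI[of _ f]) simp
qed

text \<open>Take any vertex \<open>x0\<close> of \<open>X\<close> other than \<open>w\<close>. The
  least vertex, apart from \<open>w\<close>, on the chain from \<open>w\<close> to \<open>x0\<close>
  is a child of \<open>w\<close>; it is found by the scan for the reversed order.\<close>

lemma computes_child:
  assumes p: "part I X w" and "X \<noteq> {w}"
  shows "\<exists>f. computes orc I f (\<lambda>_. 2 * real (card X)) \<and>
    (\<forall>i\<in>I. f i \<in> X \<and> covers V (R i) w (f i))"
proof -
  note X = partD[OF p]
  obtain x0 where x0: "x0 \<in> X" "x0 \<noteq> w" using assms X(6) by blast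
  let ?A = "\<lambda>i. {x \<in> X - {w}. R i x x0}"
  have "computes orc I ?A (\<lambda>_. real (card (X - {w})))"
    using X x0 by (intro computes_Collect query_mono) auto
  then have A: "computes orc I ?A (\<lambda>_. real (card X))"
    by (rule computes_mono) (use X in \<open>auto intro: card_mono\<close>)
  have "\<exists>f. computes orc I f (\<lambda>_. real (card X) + real (card X)) \<and>
      (\<forall>i\<in>I. f i \<in> ?A i \<and> (\<forall>x\<in>?A i. R i (f i) x))"
  proof (rule computes_greatest_of[OF A])
    fix i assume i: "i \<in> I"
    show "?A i \<noteq> {}" using tree_orderD(1)[OF X(3)[OF i], of x0] X(5) x0 by auto
    fix x y assume x: "x \<in> ?A i" "y \<in> ?A i"
    show "R i y x \<or> R i x y" using tree_orderD(4)[OF X(3)[OF i], of x y x0] x X(5) x0 by blast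
    fix z assume "z \<in> ?A i" "R i y x" "R i z y"
    then show "R i z x" using tree_orderD(2)[OF X(3)[OF i], of z y x] x X(5) by blast
  next
    show "computes orc I (\<lambda>i. R i y x) (\<lambda>_. 1)" if "x \<in> X" "y \<in> X" for x y
      using X that by (intro query_mono) auto
  qed (use X in auto)
  then obtain f where f: "computes orc I f (\<lambda>_. real (card X) + real (card X))"
    "\<And>i. i \<in> I \<Longrightarrow> f i \<in> ?A i" "\<And>i x. i \<in> I \<Longrightarrow> x \<in> ?A i \<Longrightarrow> R i (f i) x" by blast
  have "covers V (R i) w (f i)" if i: "i \<in> I" for i
    unfolding covers_def
  proof (intro conjI ballI impI)
    fix z assume z: "z \<in> V" "R i w z" "R i z (f i)"
    have fi: "f i \<in> X" "f i \<in> V" "R i (f i) x0" using f(2)[OF i] X(5) by auto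
    have "z \<in> X" using component_convex[OF X(2)[OF i] fi(1) z] .
    moreover have "R i z x0" using tree_orderD(2)[OF X(3)[OF i], of z "f i" x0] z fi x0 X(5) by auto
    ultimately have "z \<noteq> w \<Longrightarrow> R i (f i) z" using f(3)[OF i] by simp
    then show "z = w \<or> z = f i" using tree_orderD(3)[OF X(3)[OF i], of z "f i"] z fi by blast
  qed (use f(2)[OF i] X componentD(4)[OF X(2)[OF i]] in auto)
  then show ?thesis using f(1,2) by (intro exI[of _ f]) auto
qed

lemma part_below:
  assumes p: "part I X w" and b: "b \<in> X" "b \<noteq> w" and J: "J \<subseteq> I" "J \<noteq> {}"
    and D: "\<And>i. i \<in> J \<Longrightarrow> below (R i) X b = D"
  shows "part J D b" "part J (X - D) w" "D \<subseteq> X" "b \<in> D" "w \<notin> D"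
proof -
  note X = partD[OF p]
  have c: "component V (R i) D b" "component V (R i) (X - D) w" if "i \<in> J" for i
    using component_below[OF X(3) X(2) b(1), of i] component_diff_below[OF X(3) X(2) b, of i]
      D[OF that] that J(1) by auto
  obtain j where j: "j \<in> J" using J by blast
  show "D \<subseteq> X" using D[OF j] below_subset[of "R j" X b] by simp
  then show "part J D b" "part J (X - D) w"
    using c X J(1) componentD(1,2)[OF c(1)[OF j]] componentD(1,2)[OF c(2)[OF j]]
    unfolding part_def by (auto intro: finite_subset)
  show "b \<in> D" "w \<notin> D"
    using componentD(2)[OF c(1)[OF j]] componentD(2)[OF c(2)[OF j]] by auto
qed

text \<open>A cut costs \<open>3 * card X\<close>: \<open>card X\<close> tests for the descendants
  of \<open>b\<close>, and \<open>2 * card X\<close> queries for the parent of \<open>b\<close>,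
  which gives the only covering pair across the cut. After the tests the set \<open>D\<close> is
  known, so both sides are again parts for the smaller class \<open>J\<close>.\<close>

lemma computes_cut:
  assumes p: "part I X w" and b: "b \<in> X" "b \<noteq> w"
    and parts: "\<And>J D. J \<subseteq> I \<Longrightarrow> part J D b \<Longrightarrow> part J (X - D) w \<Longrightarrow> D \<subseteq> X \<Longrightarrow> b \<in> D \<Longrightarrow> w \<notin> D \<Longrightarrow>
      (\<And>i. i \<in> J \<Longrightarrow> below (R i) X b = D) \<Longrightarrow> J \<noteq> {} \<Longrightarrow>
      \<exists>c1 c2. computes orc J (CP D) c1 \<and> computes orc J (CP (X - D)) c2 \<and>
        (\<forall>i\<in>J. c1 i + c2 i + 3 * real (card X) \<le> C i)"
  shows "computes orc I (CP X) C"
proof -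
  note X = partD[OF p]
  have "computes orc I (\<lambda>i. {x \<in> X. R i b x}) (\<lambda>_. real (card X))"
    using X b by (intro computes_Collect query_mono) auto
  then have D: "computes orc I (\<lambda>i. below (R i) X b) (\<lambda>_. real (card X))"
    by (simp add: below_def)
  show ?thesis
  proof (rule computes_bind[OF D])
    fix D
    let ?J = "{i \<in> I. below (R i) X b = D}"
    show "computes orc ?J (CP X) (\<lambda>i. C i - real (card X))"
    proof (cases "?J = {}")
      case True
      show ?thesis unfolding True by (rule computes_const) auto
    next
      case False
      have J: "?J \<subseteq> I" "\<And>i. i \<in> ?J \<Longrightarrow> below (R i) X b = D" by auto
      note q = part_below[OF p b J(1) False J(2)]
      obtain c1 c2 where c: "computes orc ?J (CP D) c1" "computes orc ?J (CP (X - D)) c2"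
        "\<And>i. i \<in> ?J \<Longrightarrow> c1 i + c2 i + 3 * real (card X) \<le> C i"
        using parts[OF J(1) q J(2) False] by blast
      obtain f where f: "computes orc ?J f (\<lambda>_. 2 * real (card X))"
        "\<And>i. i \<in> ?J \<Longrightarrow> f i \<in> X \<and> covers V (R i) (f i) b"
        using computes_parent[OF part_subset[OF p J(1)] b] by blast
      have "computes orc ?J (\<lambda>i. (f i, CP D i, CP (X - D) i))
          (\<lambda>i. 2 * real (card X) + (c1 i + c2 i))"
        by (intro computes_pair f c)
      then have "computes orc ?J (CP X) (\<lambda>i. 2 * real (card X) + (c1 i + c2 i))"
      proof (rule computes_comp[where h = "\<lambda>(p, A, B). insert (p, b) (A \<union> B)"])
        fix i assume i: "i \<in> ?J"
        then show "CP X i = (case (f i, CP D i, CP (X - D) i) of (p, A, B) \<Rightarrow> insert (p, b) (A \<union> B))"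
          using cover_pairs_cut[OF X(3) X(5) b(1), of i "f i"] f(2)[OF i] by auto
      qed
      then show ?thesis by (rule computes_mono) (use c(3) in force)+
    qed
  qed
qed

text \<open>Cut at a child \<open>b\<close> of \<open>w\<close> and recurse on both sides. Finding
  \<open>b\<close> and cutting cost \<open>5 * card X\<close>, which is charged to the pair
  \<open>(w, b)\<close>: all of \<open>X\<close> is below \<open>w\<close>, and this pair occurs on
  neither side of the cut.\<close>

lemma computes_cover_pairs:
  assumes "part I X w"
  shows "computes orc I (CP X) (\<lambda>i. 5 * (\<Sum>(u, c)\<in>CP X i. real (card (below (R i) X u))))"
  using assms
proof (induction "card X" arbitrary: I X w rule: less_induct)
  case less
  note X = partD[OF less.prems]
  let ?K = "\<lambda>X i. 5 * (\<Sum>(u, c)\<in>CP X i. real (card (below (R i) X u)))"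
  have fin: "finite (CP Y i)" if "finite Y" for Y i
    by (rule finite_subset[of _ "Y \<times> Y"]) (use that in \<open>auto simp: cover_pairs_def\<close>)
  show ?case
  proof (cases "X = {w}")
    case True
    then show ?thesis by (intro computes_const[where x = "{}"]) auto
  next
    case False
    obtain f where f: "computes orc I f (\<lambda>_. 2 * real (card X))"
      "\<And>i. i \<in> I \<Longrightarrow> f i \<in> X \<and> covers V (R i) w (f i)"
      using computes_child[OF less.prems False] by blast
    show ?thesis
    proof (rule computes_bind[OF f(1)])
      fix b
      let ?I = "{i \<in> I. f i = b}"
      show "computes orc ?I (CP X) (\<lambda>i. ?K X i - 2 * real (card X))"
      proof (cases "?I = {}")
        case True
        show ?thesis unfolding True by (rule computes_const) auto
      next
        case False
        then have b: "b \<in> X" "b \<noteq> w" "\<And>i. i \<in> ?I \<Longrightarrow> covers V (R i) w b"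
          using f(2) by (auto simp: covers_def)
        have p: "part ?I X w" using part_subset[OF less.prems] by auto
        show ?thesis
        proof (rule computes_cut[OF p b(1,2)])
          fix J D
          assume J: "J \<subseteq> ?I" "part J D b" "part J (X - D) w" "D \<subseteq> X" "b \<in> D" "w \<notin> D"
            and D: "\<And>i. i \<in> J \<Longrightarrow> below (R i) X b = D"
          have "card D < card X" "card (X - D) < card X"
            using J X(4,6) b(1) by (auto intro!: psubset_card_mono)
          then have "computes orc J (CP D) (?K D)" "computes orc J (CP (X - D)) (?K (X - D))"
            using less.hyps J by blast+
          moreover have "?K D i + ?K (X - D) i + 3 * real (card X) \<le> ?K X i - 2 * real (card X)"
            if i: "i \<in> J" for i
          proof -
            have iI: "i \<in> I" and cov: "covers V (R i) w b" using i J b(3) by auto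
            have eq: "CP X i = insert (w, b) (CP D i \<union> CP (X - D) i)"
              using cover_pairs_cut[OF X(3)[OF iI] X(5) b(1) X(6) cov] D[OF i] by simp
            have disj: "(w, b) \<notin> CP D i \<union> CP (X - D) i" "CP D i \<inter> CP (X - D) i = {}"
              using J(4-6) by (auto simp: cover_pairs_def)
            have f': "finite (CP D i)" "finite (CP (X - D) i)" using fin J X(4) finite_subset by blast+
            have w: "below (R i) X w = X" using componentD(4)[OF X(2)[OF iI]] by (auto simp: below_def)
            have le: "real (card (below (R i) Y u)) \<le> real (card (below (R i) X u))" if "Y \<subseteq> X" for Y u
              using that X(4) by (auto simp: below_def intro!: card_mono)
            have "(\<Sum>(u, c)\<in>CP D i. real (card (below (R i) D u))) \<le>
                (\<Sum>(u, c)\<in>CP D i. real (card (below (R i) X u)))"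
              "(\<Sum>(u, c)\<in>CP (X - D) i. real (card (below (R i) (X - D) u))) \<le>
                (\<Sum>(u, c)\<in>CP (X - D) i. real (card (below (R i) X u)))"
              using le J(4) by (auto intro!: sum_mono)
            moreover have "(\<Sum>(u, c)\<in>CP X i. real (card (below (R i) X u))) = real (card X) +
                ((\<Sum>(u, c)\<in>CP D i. real (card (below (R i) X u))) +
                 (\<Sum>(u, c)\<in>CP (X - D) i. real (card (below (R i) X u))))"
              unfolding eq using f' disj w by (simp add: sum.union_disjoint)
            ultimately show ?thesis by simp
          qed
          ultimately show "\<exists>c1 c2. computes orc J (CP D) c1 \<and> computes orc J (CP (X - D)) c2 \<and>
              (\<forall>i\<in>J. c1 i + c2 i + 3 * real (card X) \<le> ?K X i - 2 * real (card X))"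
            by blast
        qed
      qed
    qed
  qed
qed

lemma sum_cover_pairs_le:
  assumes "part I X w" "i \<in> I" and nonneg: "\<And>u. 0 \<le> (g u :: real)"
  shows "(\<Sum>(u, c)\<in>CP X i. g u) \<le> real d * (\<Sum>u\<in>X. g u)"
proof -
  note X = partD[OF assms(1)]
  have "CP X i = (SIGMA u:X. {c \<in> X. covers V (R i) u c})"
    by (auto simp: cover_pairs_def)
  then have "(\<Sum>(u, c)\<in>CP X i. g u) = (\<Sum>u\<in>X. \<Sum>c | c \<in> X \<and> covers V (R i) u c. g u)"
    using X(4) by (simp only:) (subst sum.Sigma, auto)
  also have "\<dots> = (\<Sum>u\<in>X. real (card {c \<in> X. covers V (R i) u c}) * g u)" by simp
  also have "\<dots> \<le> (\<Sum>u\<in>X. real d * g u)"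
  proof (intro sum_mono mult_right_mono nonneg)
    fix u assume u: "u \<in> X"
    have "card {c \<in> X. covers V (R i) u c} \<le> card {c. covers V (R i) u c}"
      by (rule card_mono[OF finite_subset[OF _ finite_V]]) (auto simp: covers_def)
    also have "\<dots> \<le> d" using tree_orderD(5)[OF X(3)[OF assms(2)]] u X(5) by blast
    finally show "real (card {c \<in> X. covers V (R i) u c}) \<le> real d" by simp
  qed
  finally show ?thesis by (simp add: sum_distrib_left)
qed

text \<open>This crude bound settles the smallest parts in the recursion for the general
  case.\<close>

lemma computes_cover_pairs_quadratic:
  assumes "part I X w"
  shows "computes orc I (CP X) (\<lambda>_. 5 * real d * real (card X) * real (card X))"
proof (rule computes_mono[OF computes_cover_pairs[OF assms]])
  note X = partD[OF assms]
  fix i assume i: "i \<in> I"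
  have "(\<Sum>(u, c)\<in>CP X i. real (card (below (R i) X u))) \<le> real d * (\<Sum>u\<in>X. real (card (below (R i) X u)))"
    by (rule sum_cover_pairs_le[OF assms i]) simp
  also have "\<dots> \<le> real d * (\<Sum>u\<in>X. real (card X))"
    by (intro mult_left_mono sum_mono) (auto intro!: card_mono X(4) below_subset)
  finally show "5 * (\<Sum>(u, c)\<in>CP X i. real (card (below (R i) X u))) \<le> 5 * real d * real (card X) * real (card X)"
    by (simp add: mult.assoc)
qed auto

end

section \<open>Test blocks\<close>

text \<open>The probabilistic method by counting. \<open>F\<close> consists of all assignments of
  lists of \<open>2 * L\<close> block numbers to vertices. For fixed \<open>B\<close> and a fixed
  \<open>q\<close>-set \<open>H\<close>, at most a fraction \<open>4 ^ -(L * q)\<close> of them is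
  confined to \<open>B\<close> on all of \<open>H\<close>, and there are fewer than
  \<open>4 ^ (L * q)\<close> pairs of \<open>B\<close> and \<open>H\<close>. Lists instead of sets
  make the choices independent.\<close>

lemma random_tests_exist:
  fixes X :: "'v set" and q L :: nat
  assumes fin: "finite X" and card_X: "card X < 2 ^ L" and q: "1 \<le> q"
  shows "\<exists>T :: 'v \<Rightarrow> nat set. (\<forall>b. T b \<subseteq> {..<q} \<and> card (T b) \<le> 2 * L) \<and>
    (\<forall>B \<subseteq> {..<q}. 2 * card B \<le> q \<longrightarrow> card {b \<in> X. T b \<subseteq> B} < q)"
proof (cases "q \<le> card X")
  case False
  \<comment> \<open>With fewer than \<open>q\<close> vertices in all, empty test sets
    suffice.\<close>
  then have "card X < q" by simp
  then show ?thesis by (intro exI[of _ "\<lambda>_. {}"]) auto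
next
  case True
  then have L: "1 \<le> L" using card_X q by (cases L) auto
  define Y where "Y B = {l :: nat list. set l \<subseteq> B \<and> length l = 2 * L}" for B
  define F where "F = (\<Pi>\<^sub>E x\<in>X. Y {..<q})"
  define \<B> where "\<B> = {B. B \<subseteq> {..<q} \<and> 2 * card B \<le> q}"
  define \<H> where "\<H> = {H. H \<subseteq> X \<and> card H = q}"
  have card_Y: "card (Y B) = card B ^ (2 * L)" "finite (Y B)" if "finite B" for B
    using that by (auto simp: Y_def card_lists_length_eq finite_lists_length_eq)
  have fin_B: "finite B" if "B \<in> \<B>" for B
    using that finite_subset[of B "{..<q}"] by (auto simp: \<B>_def)
  have finF: "finite F" unfolding F_def by (intro finite_PiE fin card_Y) auto
  have card_F: "card F = card (Y {..<q}) ^ card X" by (simp add: F_def card_PiE fin)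
  have "0 < card F" unfolding card_F using q card_Y[of "{..<q}"] by simp
  let ?bad = "\<lambda>B H. \<Pi>\<^sub>E x\<in>X. if x \<in> H then Y B else Y {..<q}"
  \<comment> \<open>\<open>B\<close> has at most half of the blocks, so each of the \<open>q\<close>
    vertices of \<open>H\<close> loses a factor of at least \<open>2 ^ (2 * L)\<close>.\<close>
  have bad: "4 ^ (L * q) * card (?bad B H) \<le> card F" if B: "B \<in> \<B>" and H: "H \<in> \<H>" for B H
  proof -
    have "4 ^ L * card (Y B) = (2 * card B) ^ (2 * L)"
      using card_Y[OF fin_B[OF B]] by (simp add: power_mult_distrib power_mult)
    also have "\<dots> \<le> q ^ (2 * L)" using B by (intro power_mono) (auto simp: \<B>_def)
    finally have Y: "4 ^ L * card (Y B) \<le> card (Y {..<q})" by (simp add: card_Y)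
    have HX: "H \<subseteq> X" "card H = q" using H by (auto simp: \<H>_def)
    have "card (?bad B H) = (\<Prod>x\<in>X. if x \<in> H then card (Y B) else card (Y {..<q}))"
      by (simp add: card_PiE fin if_distrib)
    also have "\<dots> = card (Y B) ^ q * card (Y {..<q}) ^ card (X - H)"
      using HX fin by (subst prod.If_cases) (auto simp: Int_absorb1 Diff_eq)
    finally have "4 ^ (L * q) * card (?bad B H) = (4 ^ L * card (Y B)) ^ q * card (Y {..<q}) ^ card (X - H)"
      by (simp add: power_mult_distrib power_mult)
    also have "\<dots> \<le> card (Y {..<q}) ^ q * card (Y {..<q}) ^ card (X - H)"
      by (intro mult_right_mono power_mono Y) auto
    also have "\<dots> = card F"
      using HX fin True finite_subset[OF HX(1) fin]
      by (simp add: card_F card_Diff_subset flip: power_add)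
    finally show ?thesis .
  qed
  have "\<exists>f\<in>F. \<forall>B\<in>\<B>. card {b \<in> X. set (f b) \<subseteq> B} < q"
  proof (rule ccontr)
    assume none: "\<not> ?thesis"
    have "F \<subseteq> (\<Union>(B, H)\<in>\<B> \<times> \<H>. ?bad B H)"
    proof
      fix f assume f: "f \<in> F"
      then obtain B where B: "B \<in> \<B>" "q \<le> card {b \<in> X. set (f b) \<subseteq> B}"
        using none by (auto simp: not_less)
      then obtain H where H: "H \<subseteq> {b \<in> X. set (f b) \<subseteq> B}" "card H = q"
        by (meson obtain_subset_with_card_n)
      have "f \<in> ?bad B H" using f H by (auto simp: F_def Y_def PiE_iff)
      moreover have "H \<in> \<H>" using H by (auto simp: \<H>_def)
      ultimately show "f \<in> (\<Union>(B, H)\<in>\<B> \<times> \<H>. ?bad B H)" using B(1) by blast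
    qed
    moreover have fin_BH: "finite \<B>" "finite \<H>" using fin by (auto simp: \<B>_def \<H>_def)
    moreover have "finite (?bad B H)" if "B \<in> \<B>" for B H
      using that by (intro finite_PiE fin) (auto intro: card_Y fin_B)
    ultimately have "card F \<le> card (\<Union>(B, H)\<in>\<B> \<times> \<H>. ?bad B H)"
      by (intro card_mono) auto
    also have "\<dots> \<le> (\<Sum>(B, H)\<in>\<B> \<times> \<H>. card (?bad B H))"
      using card_UN_le[of "\<B> \<times> \<H>" "\<lambda>(B, H). ?bad B H"] fin_BH by (simp add: case_prod_unfold)
    finally have "4 ^ (L * q) * card F \<le> (\<Sum>(B, H)\<in>\<B> \<times> \<H>. 4 ^ (L * q) * card (?bad B H))"
      by (simp add: sum_distrib_left case_prod_unfold flip: sum_distrib_left)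
    also have "\<dots> \<le> (\<Sum>(B, H)\<in>\<B> \<times> \<H>. card F)"
      using bad by (intro sum_mono) auto
    also have "\<dots> = card \<B> * card \<H> * card F" by (simp add: card_cartesian_product)
    finally have "4 ^ (L * q) \<le> card \<B> * card \<H>" using \<open>0 < card F\<close> by simp
    also have "card \<B> \<le> card (Pow {..<q})" by (intro card_mono) (auto simp: \<B>_def)
    also have "\<dots> = 2 ^ q" by (simp add: card_Pow)
    also have "card \<H> = card X choose q" using n_subsets[OF fin, of q] by (simp add: \<H>_def)
    also have "\<dots> \<le> card X ^ q" by (rule binomial_le_pow[OF True])
    finally have "4 ^ (L * q) \<le> 2 ^ q * card X ^ q" by simp
    also have "\<dots> < 2 ^ q * (2 ^ L) ^ q" using card_X q by (intro mult_strict_left_mono power_strict_mono) auto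
    also have "\<dots> \<le> 2 ^ (L * q) * 2 ^ (L * q)"
      using L power_increasing[OF L, of "2::nat"]
      by (auto simp: power_mult intro!: mult_right_mono power_mono)
    also have "\<dots> = (4::nat) ^ (L * q)" by (simp flip: power_mult_distrib)
    finally show False by simp
  qed
  then obtain f where f: "f \<in> F" "\<And>B. B \<in> \<B> \<Longrightarrow> card {b \<in> X. set (f b) \<subseteq> B} < q" by blast
  have f': "set (f b) \<subseteq> {..<q}" "card (set (f b)) \<le> 2 * L" if "b \<in> X" for b
  proof -
    have "f b \<in> Y {..<q}" using f(1) that by (auto simp: F_def)
    then show "set (f b) \<subseteq> {..<q}" "card (set (f b)) \<le> 2 * L"
      using card_length[of "f b"] by (auto simp: Y_def)
  qed
  show ?thesis
  proof (intro exI[of _ "\<lambda>b. if b \<in> X then set (f b) else {}"] conjI allI impI)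
    fix B assume "B \<subseteq> {..<q}" "2 * card B \<le> q"
    then have "card {b \<in> X. set (f b) \<subseteq> B} < q" by (intro f(2)) (auto simp: \<B>_def)
    then show "card {b \<in> X. (if b \<in> X then set (f b) else {}) \<subseteq> B} < q"
      by (simp cong: conj_cong)
  qed (use f' in auto)
qed

text \<open>Number the vertices consecutively and take residues modulo \<open>q\<close>.\<close>

lemma equitable_blocks_exist:
  fixes X :: "'v set"
  assumes fin: "finite X" and q: "1 \<le> q"
  shows "\<exists>blk :: 'v \<Rightarrow> nat. (\<forall>x. blk x < q) \<and>
    (\<forall>j<q. card X div q \<le> card {x \<in> X. blk x = j} \<and> card {x \<in> X. blk x = j} \<le> card X div q + 1)"
proof -
  obtain h where h: "bij_betw h X {0..<card X}" using ex_bij_betw_finite_nat[OF fin] by blast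
  let ?N = "\<lambda>j. {n \<in> {0..<card X}. n mod q = j}"
  have eq: "card {x \<in> X. h x mod q = j} = card (?N j)" for j
  proof (rule bij_betw_same_card[of h])
    show "bij_betw h {x \<in> X. h x mod q = j} (?N j)"
      using h by (auto simp: bij_betw_def inj_on_def)
  qed
  have "card X div q \<le> card (?N j)" if "j < q" for j
  proof -
    have "(\<lambda>k. k * q + j) ` {..<card X div q} \<subseteq> ?N j"
    proof (intro image_subsetI)
      fix k assume "k \<in> {..<card X div q}"
      then have "k + 1 \<le> card X div q" by simp
      then have "(k + 1) * q \<le> card X" using q by (simp add: less_eq_div_iff_mult_less_eq)
      then show "k * q + j \<in> ?N j" using that by simp
    qed
    moreover have "inj_on (\<lambda>k. k * q + j) {..<card X div q}" using q by (auto simp: inj_on_def)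
    ultimately show ?thesis using card_inj_on_le[of "\<lambda>k. k * q + j" "{..<card X div q}" "?N j"] by simp
  qed
  moreover have "card (?N j) \<le> card X div q + 1" for j
  proof -
    have "inj_on (\<lambda>n. n div q) (?N j)"
      by (intro inj_onI) (metis (mono_tags, lifting) div_mult_mod_eq mem_Collect_eq)
    moreover have "(\<lambda>n. n div q) ` ?N j \<subseteq> {..card X div q}" by (auto intro: div_le_mono)
    ultimately show ?thesis using card_inj_on_le[of "\<lambda>n. n div q" "?N j" "{..card X div q}"] by simp
  qed
  ultimately show ?thesis using eq q by (intro exI[of _ "\<lambda>x. h x mod q"]) auto
qed

text \<open>A block that meets \<open>X'\<close> below the threshold has at least half of
  \<open>card X div q + 1\<close> vertices outside \<open>X'\<close>. Less than an eighth of
  \<open>X\<close> is missing from \<open>X'\<close>, so fewer than a quarter of the blocks are of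
  this kind and the random tests apply to them.\<close>

lemma block_sampler_exists:
  fixes X :: "'v set"
  assumes fin: "finite X" and card_X: "card X < 2 ^ L" and q: "1 \<le> q"
  shows "\<exists>(blk :: 'v \<Rightarrow> nat) T. (\<forall>x. blk x < q) \<and> (\<forall>j<q. card {x \<in> X. blk x = j} \<le> card X div q + 1) \<and>
    (\<forall>b. T b \<subseteq> {..<q} \<and> blk b \<in> T b \<and> card (T b) \<le> 2 * L + 1) \<and>
    (\<forall>X'\<subseteq>X. 7 * card X < 8 * card X' \<longrightarrow>
      card {b \<in> X. \<forall>j\<in>T b. card {x \<in> X'. blk x = j} < (card X div q + 1) div 2} < q)"
proof -
  let ?g = "card X div q"
  let ?c = "(?g + 1) div 2"
  obtain blk :: "'v \<Rightarrow> nat" where blk: "\<And>x. blk x < q"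
    "\<And>j. j < q \<Longrightarrow> ?g \<le> card {x \<in> X. blk x = j} \<and> card {x \<in> X. blk x = j} \<le> ?g + 1"
    using equitable_blocks_exist[OF fin q] by blast
  obtain T :: "'v \<Rightarrow> nat set" where T: "\<And>b. T b \<subseteq> {..<q}" "\<And>b. card (T b) \<le> 2 * L"
    "\<And>B. B \<subseteq> {..<q} \<Longrightarrow> 2 * card B \<le> q \<Longrightarrow> card {b \<in> X. T b \<subseteq> B} < q"
    using random_tests_exist[OF fin card_X q] by blast
  \<comment> \<open>Testing also the own block settles comparisons inside a block, and it can only
    shrink the set that has to be bounded.\<close>
  let ?T = "\<lambda>b. insert (blk b) (T b)"
  have "card {b \<in> X. \<forall>j\<in>?T b. card {x \<in> X'. blk x = j} < ?c} < q"
    if X': "X' \<subseteq> X" and large: "7 * card X < 8 * card X'" for X'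
  proof -
    define B where "B = {j \<in> {..<q}. card {x \<in> X'. blk x = j} < ?c}"
    have "?g + 1 \<le> 2 * card {x \<in> X - X'. blk x = j}" if "j \<in> B" for j
    proof -
      have "card {x \<in> X. blk x = j} = card {x \<in> X'. blk x = j} + card {x \<in> X - X'. blk x = j}"
        using X' fin finite_subset[OF X' fin] by (subst card_Un_disjoint[symmetric]) (auto intro!: arg_cong[where f = card])
      moreover have "j < q" "card {x \<in> X'. blk x = j} < ?c" using that by (simp_all add: B_def)
      moreover have "?g \<le> card {x \<in> X. blk x = j}" using blk(2) \<open>j < q\<close> by blast
      ultimately show ?thesis by linarith
    qed
    then have "card B * (?g + 1) \<le> (\<Sum>j\<in>B. 2 * card {x \<in> X - X'. blk x = j})"
      using sum_mono[of B "\<lambda>_. ?g + 1" "\<lambda>j. 2 * card {x \<in> X - X'. blk x = j}"] by simp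
    also have "\<dots> = 2 * card (\<Union>j\<in>B. {x \<in> X - X'. blk x = j})"
      using fin by (subst card_UN_disjoint) (auto simp: B_def sum_distrib_left)
    also have "\<dots> \<le> 2 * card (X - X')" using fin by (intro mult_left_mono card_mono) auto
    also have "\<dots> = 2 * (card X - card X')" using X' fin finite_subset[OF X' fin] by (simp add: card_Diff_subset)
    finally have "4 * (card B * (?g + 1)) < card X" using large card_mono[OF fin X'] by linarith
    also have "\<dots> < q * (?g + 1)" using q dividend_less_times_div[of q "card X"] by simp
    finally have "(4 * card B) * (?g + 1) < q * (?g + 1)" by simp
    then have "4 * card B < q" by (simp only: mult_less_cancel2)
    then have "2 * card B \<le> q" by linarith
    then have "card {b \<in> X. T b \<subseteq> B} < q" by (intro T(3)) (auto simp: B_def)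
    moreover have "card {b \<in> X. \<forall>j\<in>?T b. card {x \<in> X'. blk x = j} < ?c} \<le> card {b \<in> X. T b \<subseteq> B}"
      using fin T(1) by (intro card_mono) (auto simp: B_def)
    ultimately show ?thesis by simp
  qed
  moreover have "card (?T b) \<le> 2 * L + 1" for b
    using T(2)[of b] card_insert_le_m1[of "2 * L + 1" "T b" "blk b"] by simp
  ultimately show ?thesis using blk T(1,2)
    by (intro exI[of _ blk] exI[of _ ?T]) auto
qed

section \<open>Balanced decomposition\<close>

text \<open>In use, \<open>F\<close> holds the tested pairs with a positive answer, so the
  candidates are known without further queries. The top \<open>w\<close> is excluded because no cut
  is made there.\<close>

definition candidates ::
  "('v \<Rightarrow> nat) \<Rightarrow> ('v \<Rightarrow> nat set) \<Rightarrow> nat \<Rightarrow> ('v \<times> 'v) set \<Rightarrow> 'v set \<Rightarrow> 'v \<Rightarrow> 'v set" where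
  "candidates blk T c F X w =
     {b \<in> X - {w}. \<exists>j\<in>T b. c \<le> card {x \<in> X. blk x = j \<and> (b, x) \<in> F}}"

lemma candidates_mono:
  assumes "finite X" "Y \<subseteq> X" "w \<notin> Y \<or> w = w'"
  shows "candidates blk T c F Y w' \<subseteq> candidates blk T c F X w"
proof
  fix b assume "b \<in> candidates blk T c F Y w'"
  then obtain j where j: "b \<in> Y - {w'}" "j \<in> T b" "c \<le> card {x \<in> Y. blk x = j \<and> (b, x) \<in> F}"
    by (auto simp: candidates_def)
  have "card {x \<in> Y. blk x = j \<and> (b, x) \<in> F} \<le> card {x \<in> X. blk x = j \<and> (b, x) \<in> F}"
    using assms by (intro card_mono) auto
  with j(3) have "c \<le> card {x \<in> X. blk x = j \<and> (b, x) \<in> F}" by (rule le_trans)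
  then show "b \<in> candidates blk T c F X w"
    using j(1,2) assms(2,3) unfolding candidates_def by blast
qed

context ancestor_queries
begin

lemma card_children_le:
  assumes "part I X w" "i \<in> I" "u \<in> X"
  shows "card (children V (R i) X u) \<le> d"
proof -
  have "card (children V (R i) X u) \<le> card {c. covers V (R i) u c}"
    by (rule card_mono[OF finite_subset[OF _ finite_V]]) (auto simp: covers_def children_def)
  also have "\<dots> \<le> d" using tree_orderD(5)[OF partD(3)[OF assms(1,2)]] assms(3) partD(5)[OF assms(1)] by blast
  finally show ?thesis .
qed

text \<open>
  \<open>H\<close> collects the vertices moved to without having been candidates. They meet the current part
  below the threshold in all their test blocks, so the sampler bounds their number by \<open>k\<close>.
\<close>

definition potential ::
  "nat \<Rightarrow> nat \<Rightarrow> ('v \<Rightarrow> nat) \<Rightarrow> ('v \<Rightarrow> nat set) \<Rightarrow> ('v \<times> 'v) set \<Rightarrow> 'v set \<Rightarrow> 'v \<Rightarrow> 'v set \<Rightarrow> 'i \<Rightarrow> real" where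
  "potential k c blk T F X w H i =
     (real (card (blk ` candidates blk T c F X w)) + real k - real (card H)) * (real d + 1) +
     real (card (children V (R i) X w)) + real (card X) / real c"

text \<open>Each cut costs at most \<open>5 * card X0\<close> and lowers the potential by at least
  1. Moving down to \<open>b\<close> removes a block from those with candidates or adds
  \<open>b\<close> to \<open>H\<close>; the factor \<open>d + 1\<close> outweighs the at most
  \<open>d\<close> children that appear. Otherwise the part loses a child of \<open>w\<close> or at
  least \<open>c\<close> vertices.\<close>

lemma computes_stage:
  fixes blk :: "'v \<Rightarrow> nat" and lam :: real
  assumes X0: "finite X0" and c: "1 \<le> c" and lam: "0 \<le> lam"
    and own: "\<And>b. blk b \<in> T b"
    and sampler: "\<And>X. X \<subseteq> X0 \<Longrightarrow> 7 * card X0 < 8 * card X \<Longrightarrow>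
      card {b \<in> X0. \<forall>j\<in>T b. card {x \<in> X. blk x = j} < c} < k"
    and F: "\<And>i b x. i \<in> I0 \<Longrightarrow> b \<in> X0 \<Longrightarrow> x \<in> X0 \<Longrightarrow> blk x \<in> T b \<Longrightarrow> R i b x \<longleftrightarrow> (b, x) \<in> F"
    and IH: "\<And>I X w. part I X w \<Longrightarrow> X \<subseteq> X0 \<Longrightarrow> 8 * card X \<le> 7 * card X0 \<Longrightarrow>
      computes orc I (CP X) (\<lambda>_. lam * real (card X))"
    and "part I X w" "I \<subseteq> I0" "X \<subseteq> X0" "H \<subseteq> X0" "card H \<le> k" "H \<inter> X \<subseteq> {w}"
    and "\<And>h j. h \<in> H \<Longrightarrow> j \<in> T h \<Longrightarrow> card {x \<in> X. blk x = j} < c"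
  shows "computes orc I (CP X)
    (\<lambda>i. lam * real (card X) + 5 * real (card X0) * potential k c blk T F X w H i)"
  using assms(8-)
proof (induction "card X" arbitrary: I X w H rule: less_induct)
  case less
  note p = less.prems(1)
  note X = partD[OF p]
  let ?s = "real (card X0)"
  let ?P = "potential k c blk T F"
  have pot: "0 \<le> ?P X w H i" if "card H \<le> k" for X w H i
    using that by (auto simp: potential_def intro!: add_nonneg_nonneg mult_nonneg_nonneg)
  have fin_H: "finite H" using less.prems(4) X0 finite_subset by blast
  have Xs: "card X \<le> card X0" using less.prems(3) X0 card_mono by blast

  text \<open>Both branches of a stage cut at some \<open>b\<close> and continue with the larger side; they differ
    only in the reason why the potential drops.\<close>
  have step: "computes orc J (CP X)
      (\<lambda>i. lam * real (card X) + 5 * ?s * ?P X w H i - 2 * real (card X))"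
    if b: "b \<in> X" "b \<noteq> w" and J: "J \<subseteq> I" and H': "H \<subseteq> H'" "H' \<subseteq> insert b H"
      and kH: "card H' \<le> k" and fails: "b \<in> H' \<Longrightarrow> \<forall>j\<in>T b. card {x \<in> X. b \<in> X0 \<and> blk x = j \<and> (b, x) \<in> F} < c"
      and heavy: "\<And>D i. i \<in> J \<Longrightarrow> D = below (R i) X b \<Longrightarrow> w \<notin> D \<Longrightarrow> b \<in> D \<Longrightarrow> ?P D b H' i \<le> ?P X w H i - 1"
      and light: "\<And>D i. i \<in> J \<Longrightarrow> D = below (R i) X b \<Longrightarrow> w \<notin> D \<Longrightarrow> b \<in> D \<Longrightarrow> ?P (X - D) w H i \<le> ?P X w H i - 1"
    for J b H'
  proof (rule computes_cut[OF part_subset[OF p J] b])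
    fix J' D
    assume J': "J' \<subseteq> J" "part J' D b" "part J' (X - D) w" "D \<subseteq> X" "b \<in> D" "w \<notin> D"
      and D: "\<And>i. i \<in> J' \<Longrightarrow> below (R i) X b = D" and ne: "J' \<noteq> {}"
    have lt: "card D < card X" "card (X - D) < card X"
      using J' X(4,6) b(1) by (auto intro!: psubset_card_mono)
    have sum: "card D + card (X - D) = card X"
      using J'(4) X(4) by (metis card_Diff_subset card_mono finite_subset le_add_diff_inverse)
    have sub: "J' \<subseteq> I0" "D \<subseteq> X0" "X - D \<subseteq> X0" using J' J less.prems(2,3) by auto
    have cost: "lam * real (card D) + lam * real (card (X - D)) = lam * real (card X)"
      by (simp flip: sum distrib_left of_nat_add)
    show "\<exists>c1 c2. computes orc J' (CP D) c1 \<and> computes orc J' (CP (X - D)) c2 \<and>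
        (\<forall>i\<in>J'. c1 i + c2 i + 3 * real (card X) \<le>
          lam * real (card X) + 5 * ?s * ?P X w H i - 2 * real (card X))"
    \<comment> \<open>The smaller side has at most half of \<open>X\<close>, so \<open>IH\<close>
      handles it; only the larger side carries the potential on.\<close>
    proof (cases "card X \<le> 2 * card D")
      case True
      have "computes orc J' (CP D) (\<lambda>i. lam * real (card D) + 5 * ?s * ?P D b H' i)"
      proof (rule less.hyps[OF lt(1) J'(2) sub(1,2) _ kH])
        show "H' \<subseteq> X0" using H' less.prems(3,4) b by auto
        show "H' \<inter> D \<subseteq> {b}" using H' less.prems(6) J'(4,6) by blast
        fix h j assume h: "h \<in> H'" "j \<in> T h"
        show "card {x \<in> D. blk x = j} < c"
        proof (cases "h \<in> H")
          case True
          have "card {x \<in> D. blk x = j} \<le> card {x \<in> X. blk x = j}"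
            using J'(4) X(4) by (intro card_mono) auto
          then show ?thesis using less.prems(7)[OF True h(2)] by simp
        next
          case False
          then have hb: "h = b" using H' h by blast
          \<comment> \<open>Any instance will do: \<open>D\<close> is the set of descendants of
            \<open>b\<close>, so its vertices in a tested block are recorded in \<open>F\<close> and
            are counted by \<open>fails\<close>.\<close>
          obtain i where i: "i \<in> J'" using ne by blast
          have "card {x \<in> D. blk x = j} \<le> card {x \<in> X. b \<in> X0 \<and> blk x = j \<and> (b, x) \<in> F}"
            using F[of i b] i sub J'(4) less.prems(3) b D[OF i] h hb
            by (intro card_mono) (auto simp: below_def X(4) subset_eq)
          then show ?thesis using fails h hb by fastforce
        qed
      qed
      moreover have "8 * card (X - D) \<le> 7 * card X0" using True sum Xs by linarith
      then have "computes orc J' (CP (X - D)) (\<lambda>_. lam * real (card (X - D)))"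
        using IH[OF J'(3) sub(3)] by blast
      moreover have "lam * real (card D) + 5 * ?s * ?P D b H' i + lam * real (card (X - D)) + 3 * real (card X) \<le>
          lam * real (card X) + 5 * ?s * ?P X w H i - 2 * real (card X)" if "i \<in> J'" for i
      proof -
        \<comment> \<open>The drop by 1 frees \<open>5 * ?s\<close>, which pays for the cut and for
          the reserve of \<open>2 * card X\<close> for finding \<open>b\<close>.\<close>
        have "5 * ?s * ?P D b H' i \<le> 5 * ?s * (?P X w H i - 1)"
          using heavy[of i D] D[OF that] that J'(1,5,6) by (intro mult_left_mono) auto
        then show ?thesis using cost Xs by (simp add: algebra_simps)
      qed
      ultimately show ?thesis by blast
    next
      case False
      have "computes orc J' (CP (X - D)) (\<lambda>i. lam * real (card (X - D)) + 5 * ?s * ?P (X - D) w H i)"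
      proof (rule less.hyps[OF lt(2) J'(3) sub(1,3) less.prems(4,5)])
        show "H \<inter> (X - D) \<subseteq> {w}" using less.prems(6) by blast
        fix h j assume h: "h \<in> H" "j \<in> T h"
        have "card {x \<in> X - D. blk x = j} \<le> card {x \<in> X. blk x = j}"
          using X(4) by (intro card_mono) auto
        then show "card {x \<in> X - D. blk x = j} < c" using less.prems(7)[OF h] by simp
      qed
      moreover have "8 * card D \<le> 7 * card X0" using False sum Xs by linarith
      then have "computes orc J' (CP D) (\<lambda>_. lam * real (card D))"
        using IH[OF J'(2) sub(2)] by blast
      moreover have "lam * real (card D) + (lam * real (card (X - D)) + 5 * ?s * ?P (X - D) w H i) + 3 * real (card X) \<le>
          lam * real (card X) + 5 * ?s * ?P X w H i - 2 * real (card X)" if "i \<in> J'" for i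
      proof -
        have "5 * ?s * ?P (X - D) w H i \<le> 5 * ?s * (?P X w H i - 1)"
          using light[of i D] D[OF that] that J'(1,5,6) by (intro mult_left_mono) auto
        then show ?thesis using cost Xs by (simp add: algebra_simps)
      qed
      ultimately show ?thesis by blast
    qed
  qed

  consider "8 * card X \<le> 7 * card X0" | "X = {w}" | "I = {}"
    | "7 * card X0 < 8 * card X" "X \<noteq> {w}" "I \<noteq> {}" "candidates blk T c F X w = {}"
    | "7 * card X0 < 8 * card X" "I \<noteq> {}" "candidates blk T c F X w \<noteq> {}"
    by fastforce
  then show ?case
  proof cases
    case 1
    show ?thesis
      by (rule computes_mono[OF IH[OF p less.prems(3) 1]]) (use pot[OF less.prems(5)] in auto)
  next
    case 2
    then show ?thesis
      using pot[OF less.prems(5)] lam by (intro computes_const[where x = "{}"]) auto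
  next
    case 3
    then show ?thesis by (intro computes_const[where x = "{}"]) auto
  next
    case 4
    \<comment> \<open>All members of \<open>H\<close> fail their tests on \<open>X\<close>, which is
      still large, so the sampler leaves room for one more member.\<close>
    have "H \<subseteq> {b \<in> X0. \<forall>j\<in>T b. card {x \<in> X. blk x = j} < c}" using less.prems(4,7) by blast
    then have "card H \<le> card {b \<in> X0. \<forall>j\<in>T b. card {x \<in> X. blk x = j} < c}"
      using X0 by (intro card_mono) auto
    then have "card H < k" using sampler[OF less.prems(3) 4(1)] by simp
    obtain f where f: "computes orc I f (\<lambda>_. 2 * real (card X))"
      "\<And>i. i \<in> I \<Longrightarrow> f i \<in> X \<and> covers V (R i) w (f i)"
      using computes_child[OF p 4(2)] by blast
    show ?thesis
    proof (rule computes_bind[OF f(1)])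
      fix b
      let ?J = "{i \<in> I. f i = b}"
      show "computes orc ?J (CP X)
          (\<lambda>i. lam * real (card X) + 5 * ?s * ?P X w H i - 2 * real (card X))"
      proof (cases "?J = {}")
        case True
        show ?thesis unfolding True by (rule computes_const) auto
      next
        case False
        then have b: "b \<in> X" "b \<noteq> w" "\<And>i. i \<in> ?J \<Longrightarrow> covers V (R i) w b"
          using f(2) by (auto simp: covers_def)
        have bH: "b \<notin> H" using b less.prems(6) by blast
        have no: "blk ` candidates blk T c F Y w' = {}" if "Y \<subseteq> X" "w \<notin> Y \<or> w = w'" for Y w'
          using candidates_mono[OF X(4) that] 4(4) by blast
        have cX: "real (card Y) / real c \<le> real (card X) / real c" if "Y \<subseteq> X" for Y
          using that X(4) by (intro divide_right_mono) (auto intro: card_mono)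
        show ?thesis
        proof (rule step[OF b(1,2), where H' = "insert b H"])
          show "card (insert b H) \<le> k" using bH fin_H \<open>card H < k\<close> by simp
          show "\<forall>j\<in>T b. card {x \<in> X. b \<in> X0 \<and> blk x = j \<and> (b, x) \<in> F} < c"
          proof
            fix j assume "j \<in> T b"
            then have "\<not> c \<le> card {x \<in> X. blk x = j \<and> (b, x) \<in> F}"
              using 4(4) b(1,2) by (auto simp: candidates_def)
            then show "card {x \<in> X. b \<in> X0 \<and> blk x = j \<and> (b, x) \<in> F} < c"
              using b(1) less.prems(3) by (simp add: subset_eq)
          qed
        next
          fix D i assume i: "i \<in> ?J" and D: "D = below (R i) X b" "w \<notin> D" "b \<in> D"
          have DX: "D \<subseteq> X" using D below_subset by metis
          have "part {i} D b" using part_below(1)[OF p b(1,2), of "{i}" D] i D by auto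
          then have "card (children V (R i) D b) \<le> d" using card_children_le[of "{i}" D b i] D by simp
          \<comment> \<open>There are no candidates before or after the move. The growth of
            \<open>H\<close> saves \<open>d + 1\<close>, and \<open>b\<close> has at most
            \<open>d\<close> children.\<close>
          then show "?P D b (insert b H) i \<le> ?P X w H i - 1"
            unfolding potential_def using no[OF DX, of b] no[of X w] D(2) cX[OF DX] bH fin_H
            by (simp add: algebra_simps)
        next
          fix D i assume i: "i \<in> ?J" and D: "D = below (R i) X b" "w \<notin> D" "b \<in> D"
          have "children V (R i) (X - D) w \<subset> children V (R i) X w"
            using b(1) b(3)[OF i] D by (auto simp: children_def)
          then have "card (children V (R i) (X - D) w) < card (children V (R i) X w)"
            using X(4) by (intro psubset_card_mono) (auto simp: children_def)
          then show "?P (X - D) w H i \<le> ?P X w H i - 1"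
            unfolding potential_def using no[of "X - D" w] no[of X w] cX[of "X - D"] by simp
        qed auto
      qed
    qed
  next
    case 5
    obtain i0 where i0: "i0 \<in> I" using 5 by blast
    obtain b0 where b0: "b0 \<in> candidates blk T c F X w" using 5 by blast
    let ?Q = "\<lambda>b. b \<in> candidates blk T c F X w \<and> blk b = blk b0"
    \<comment> \<open>A candidate with fewest descendants in the instance \<open>i0\<close> is
      lowest in its block. As the own block is tested, \<open>F\<close> fixes its comparisons with
      candidates of this block, so it is lowest in every instance of \<open>I\<close>.\<close>
    obtain b where b: "?Q b" and min: "\<And>b'. ?Q b' \<Longrightarrow> card (below (R i0) X b) \<le> card (below (R i0) X b')"
      using ex_has_least_nat[of ?Q b0 "\<lambda>b. card (below (R i0) X b)"] b0 by blast
    have cand: "b' \<in> X" "b' \<noteq> w" if "?Q b'" for b' using that by (auto simp: candidates_def)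
    have agree: "R i b b' \<longleftrightarrow> R i0 b b'" if "?Q b'" "i \<in> I" for i b'
      using F[of i b b'] F[of i0 b b'] that i0 b cand[OF b] cand[OF that(1)] less.prems(2,3) own[of b] by auto
    have bottom: "b' = b" if "?Q b'" "R i b b'" "i \<in> I" for b' i
    proof (rule ccontr)
      assume "b' \<noteq> b"
      have bb: "R i0 b b'" using agree that by blast
      have V: "b \<in> V" "b' \<in> V" using cand b that(1) X(5) by auto
      have "below (R i0) X b' \<subseteq> below (R i0) X b"
        using tree_orderD(2)[OF X(3)[OF i0], of b b'] V X(5) bb by (auto simp: below_def)
      moreover have "b \<notin> below (R i0) X b'"
        using tree_orderD(3)[OF X(3)[OF i0], of b b'] V bb \<open>b' \<noteq> b\<close> by (auto simp: below_def)
      moreover have "b \<in> below (R i0) X b"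
        using tree_orderD(1)[OF X(3)[OF i0]] V cand[OF b] by (simp add: below_def)
      ultimately have "card (below (R i0) X b') < card (below (R i0) X b)"
        using X(4) by (intro psubset_card_mono) (auto simp: below_def)
      then show False using min[OF that(1)] by simp
    qed
    obtain j where j: "j \<in> T b" "c \<le> card {x \<in> X. blk x = j \<and> (b, x) \<in> F}"
      using b by (auto simp: candidates_def)
    have fin_c: "finite (candidates blk T c F X w)" using X(4) by (simp add: candidates_def)
    have "computes orc I (CP X) (\<lambda>i. lam * real (card X) + 5 * ?s * ?P X w H i - 2 * real (card X))"
    proof (rule step[OF cand[OF b], where H' = H])
      show "\<forall>j\<in>T b. card {x \<in> X. b \<in> X0 \<and> blk x = j \<and> (b, x) \<in> F} < c" if "b \<in> H"
        using that less.prems(6) cand[OF b] by blast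
    next
      fix D i assume i: "i \<in> I" and D: "D = below (R i) X b" "w \<notin> D" "b \<in> D"
      have DX: "D \<subseteq> X" using D below_subset by metis
      have "part {i} D b" using part_below(1)[OF p cand[OF b], of "{i}" D] i D by auto
      then have ch: "card (children V (R i) D b) \<le> d" using card_children_le[of "{i}" D b i] D by simp
      have cm: "candidates blk T c F D b \<subseteq> candidates blk T c F X w"
        by (rule candidates_mono[OF X(4) DX]) (use D in auto)
      \<comment> \<open>No candidate of the block of \<open>b\<close> lies properly below
        \<open>b\<close>, so this block disappears from the count, which pays for the new
        children.\<close>
      have "blk b \<notin> blk ` candidates blk T c F D b"
      proof
        assume "blk b \<in> blk ` candidates blk T c F D b"
        then obtain b' where b': "b' \<in> candidates blk T c F D b" "blk b' = blk b" by (metis imageE)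
        then have "b' \<in> D" "b' \<noteq> b" by (auto simp: candidates_def)
        then show False using bottom[of b' i] b' cm b i D(1) by (auto simp: below_def)
      qed
      then have "blk ` candidates blk T c F D b \<subset> blk ` candidates blk T c F X w"
        using cm b by blast
      then have "card (blk ` candidates blk T c F D b) + 1 \<le> card (blk ` candidates blk T c F X w)"
        using fin_c by (simp add: Suc_le_eq psubset_card_mono)
      then have "(real (card (blk ` candidates blk T c F D b)) + 1 + real k - real (card H)) * (real d + 1)
          \<le> (real (card (blk ` candidates blk T c F X w)) + real k - real (card H)) * (real d + 1)"
        by (intro mult_right_mono) auto
      moreover have "real (card D) / real c \<le> real (card X) / real c"
        using DX X(4) by (intro divide_right_mono) (auto intro: card_mono)
      ultimately show "?P D b H i \<le> ?P X w H i - 1"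
        unfolding potential_def using ch by (simp add: algebra_simps)
    next
      fix D i assume i: "i \<in> I" and D: "D = below (R i) X b" "w \<notin> D" "b \<in> D"
      have DX: "D \<subseteq> X" using D below_subset by metis
      \<comment> \<open>The block that makes \<open>b\<close> a candidate contributes at least
        \<open>c\<close> vertices to \<open>D\<close>, so \<open>card X / c\<close> drops by at
        least 1.\<close>
      have "{x \<in> X. blk x = j \<and> (b, x) \<in> F} \<subseteq> D"
        using F[of i b] i j(1) cand[OF b] less.prems(2,3) by (auto simp: D(1) below_def)
      then have "c \<le> card D" using j(2) X(4) DX by (meson card_mono finite_subset le_trans)
      then have "card (X - D) + c \<le> card X"
        using DX X(4) by (metis add_le_cancel_left card_Diff_subset card_mono finite_subset le_add_diff_inverse2)
      then have "real (card (X - D)) + real c \<le> real (card X)" by linarith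
      then have "real (card (X - D)) / real c \<le> real (card X) / real c - 1"
        using c by (simp add: field_simps)
      moreover have "real (card (children V (R i) (X - D) w)) \<le> real (card (children V (R i) X w))"
        using X(4) by (intro of_nat_mono card_mono) (auto simp: children_def)
      moreover have "card (blk ` candidates blk T c F (X - D) w) \<le> card (blk ` candidates blk T c F X w)"
        using candidates_mono[OF X(4), of "X - D" w w] fin_c by (intro card_mono image_mono) auto
      then have "(real (card (blk ` candidates blk T c F (X - D) w)) + real k - real (card H)) * (real d + 1)
          \<le> (real (card (blk ` candidates blk T c F X w)) + real k - real (card H)) * (real d + 1)"
        by (intro mult_right_mono) auto
      ultimately show "?P (X - D) w H i \<le> ?P X w H i - 1"
        unfolding potential_def by linarith
    qed (use less.prems(5) in auto)
    \<comment> \<open>Selecting a candidate needs no queries, so the reserve is left over.\<close>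
    then show ?thesis by (rule computes_mono) auto
  qed
qed

end

section \<open>From one stage to the full recursion\<close>

context ancestor_queries
begin

text \<open>The three summands pay for the small parts, for the tests of each vertex against at most
  \<open>2 * L + 1\<close> blocks, and for the stage. The initial potential is bounded by taking
  \<open>k = q\<close> and \<open>H\<close> empty: at most \<open>q\<close> blocks hold candidates,
  and \<open>w\<close> has at most \<open>d\<close> children.\<close>

lemma computes_split:
  fixes lam :: real
  assumes p: "part I X w" and L: "card X < 2 ^ L" and q: "1 \<le> q" "q \<le> card X" and lam: "0 \<le> lam"
    and IH: "\<And>J Y v. part J Y v \<Longrightarrow> Y \<subseteq> X \<Longrightarrow> 8 * card Y \<le> 7 * card X \<Longrightarrow>
      computes orc J (CP Y) (\<lambda>_. lam * real (card Y))"
  shows "computes orc I (CP X) (\<lambda>_. lam * real (card X) +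
    real (card X) * ((2 * real L + 1) * (real (card X div q) + 1)) +
    5 * real (card X) * (2 * real q * (real d + 1) + real d + 4 * real q))"
proof -
  note X = partD[OF p]
  let ?g = "card X div q"
  let ?c = "(?g + 1) div 2"
  have "1 \<le> ?g" using q by (simp add: Suc_le_eq div_greater_zero_iff)
  \<comment> \<open>Together these give \<open>?g + 1 \<le> 4 * ?c\<close>, hence at most
    \<open>4 * q\<close> for the last summand of the potential.\<close>
  then have c: "1 \<le> ?c" "2 * ?g \<ge> ?g + 1" "2 * ?c \<ge> ?g" by linarith+
  have "card X \<le> (?g + 1) * q" using dividend_less_times_div[of q "card X"] q(1) by (simp add: algebra_simps)
  also have "\<dots> \<le> 2 * (2 * ?c) * q" using c by (intro mult_right_mono) auto
  finally have "real (card X) \<le> real (2 * (2 * ?c) * q)" by linarith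
  then have Xc: "real (card X) / real ?c \<le> 4 * real q"
    using c(1) by (simp add: pos_divide_le_eq mult_ac)
  obtain blk T where blk: "\<And>x. blk x < q" "\<And>j. j < q \<Longrightarrow> card {x \<in> X. blk x = j} \<le> ?g + 1"
    and T: "\<And>b. T b \<subseteq> {..<q}" "\<And>b. blk b \<in> T b" "\<And>b. card (T b) \<le> 2 * L + 1"
    and sampler: "\<And>X'. X' \<subseteq> X \<Longrightarrow> 7 * card X < 8 * card X' \<Longrightarrow>
      card {b \<in> X. \<forall>j\<in>T b. card {x \<in> X'. blk x = j} < ?c} < q"
    using block_sampler_exists[OF X(4) L q(1)] by blast
  let ?S = "SIGMA b:X. {x \<in> X. blk x \<in> T b}"
  have "card {x \<in> X. blk x \<in> T b} \<le> (2 * L + 1) * (?g + 1)" for b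
  proof -
    have "{x \<in> X. blk x \<in> T b} = (\<Union>j\<in>T b. {x \<in> X. blk x = j})" by auto
    also have "card \<dots> \<le> (\<Sum>j\<in>T b. card {x \<in> X. blk x = j})"
      using T(1)[of b] by (intro card_UN_le) (auto intro: finite_subset)
    also have "\<dots> \<le> (\<Sum>j\<in>T b. ?g + 1)" using T(1)[of b] blk(2) by (intro sum_mono) blast
    also have "\<dots> \<le> (2 * L + 1) * (?g + 1)" using mult_right_mono[OF T(3)[of b], of "?g + 1"] by simp
    finally show ?thesis .
  qed
  then have "card ?S \<le> card X * ((2 * L + 1) * (?g + 1))"
    using X(4) sum_bounded_above[of X "\<lambda>b. card {x \<in> X. blk x \<in> T b}" "(2 * L + 1) * (?g + 1)"] by simp
  then have card_S: "real (card ?S) \<le> real (card X) * ((2 * real L + 1) * (real ?g + 1))"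
    using of_nat_mono[of "card ?S" "card X * ((2 * L + 1) * (?g + 1))", where 'a = real]
    by (simp add: algebra_simps)
  have "computes orc I (\<lambda>i. {y \<in> ?S. case y of (b, x) \<Rightarrow> R i b x}) (\<lambda>_. real (card ?S))"
  proof (rule computes_Collect)
    show "finite ?S" using X(4) by auto
    fix y assume "y \<in> ?S"
    then obtain b x where "y = (b, x)" "b \<in> V" "x \<in> V" using X(5) by blast
    then show "computes orc I (\<lambda>i. case y of (b, x) \<Rightarrow> R i b x) (\<lambda>_. 1)"
      using query_mono[OF X(1), of b x] by simp
  qed
  then show ?thesis
  proof (rule computes_bind)
    fix F
    let ?J = "{i \<in> I. {y \<in> ?S. case y of (b, x) \<Rightarrow> R i b x} = F}"
    have J: "part ?J X w" by (rule part_subset[OF p]) auto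
    have F: "R i b x \<longleftrightarrow> (b, x) \<in> F" if "i \<in> ?J" "b \<in> X" "x \<in> X" "blk x \<in> T b" for i b x
      using that by auto
    have "computes orc ?J (CP X)
        (\<lambda>i. lam * real (card X) + 5 * real (card X) * potential q ?c blk T F X w {} i)"
      by (rule computes_stage[where ?I0.0 = "?J" and ?X0.0 = X])
        (fact X(4) c(1) lam T(2) J | erule (1) sampler | erule (3) F | erule (2) IH | simp)+
    then show "computes orc ?J (CP X) (\<lambda>i. lam * real (card X) +
        real (card X) * ((2 * real L + 1) * (real ?g + 1)) +
        5 * real (card X) * (2 * real q * (real d + 1) + real d + 4 * real q) - real (card ?S))"
    proof (rule computes_mono)
      fix i assume i: "i \<in> ?J"
      have "card (blk ` candidates blk T ?c F X w) \<le> card {..<q}"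
        using blk(1) by (intro card_mono) auto
      then have "(real (card (blk ` candidates blk T ?c F X w)) + real q) * (real d + 1)
          \<le> 2 * real q * (real d + 1)"
        by (intro mult_right_mono) auto
      moreover have "real (card (children V (R i) X w)) \<le> real d"
        using card_children_le[OF J i X(6)] by simp
      ultimately have "potential q ?c blk T F X w {} i \<le> 2 * real q * (real d + 1) + real d + 4 * real q"
        unfolding potential_def card.empty of_nat_0 diff_zero using Xc by linarith
      then have "5 * real (card X) * potential q ?c blk T F X w {} i \<le>
          5 * real (card X) * (2 * real q * (real d + 1) + real d + 4 * real q)"
        by (intro mult_left_mono) auto
      then show "lam * real (card X) + 5 * real (card X) * potential q ?c blk T F X w {} i \<le>
          lam * real (card X) + real (card X) * ((2 * real L + 1) * (real ?g + 1)) +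
          5 * real (card X) * (2 * real q * (real d + 1) + real d + 4 * real q) - real (card ?S)"
        using card_S by linarith
    qed auto
  qed
qed

text \<open>With \<open>m = sqrt (s * L)\<close>, where \<open>s = card X\<close>, and
  \<open>q\<close> its ceiling, the tests cost at most \<open>6 * m\<close> per vertex and the stage
  at most \<open>(25 * d + 60) * m\<close>, together \<open>K * m / 16\<close>. Since
  \<open>7 / 8 \<le> (15 / 16)\<^sup>2\<close>, the small parts cost at most
  \<open>15 / 16 * K * m\<close> per vertex, which leaves exactly this amount.\<close>

lemma computes_cover_pairs_subquadratic:
  assumes "part I X w" and L: "1 \<le> L" "card V < 2 ^ L"
  defines "K \<equiv> 16 * (25 * real d + 66)"
  shows "computes orc I (CP X) (\<lambda>_. K * sqrt (real L) * real (card X) * sqrt (real (card X)))"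
  using assms(1)
proof (induction "card X" arbitrary: I X w rule: less_induct)
  case less
  note X = partD[OF less.prems]
  let ?s = "card X"
  have K: "0 \<le> K" "5 * real d \<le> K" by (simp_all add: K_def)
  show ?case
  proof (cases "?s \<le> L")
    case True
    have "5 * real d * real ?s * real ?s = 5 * real d * real ?s * (sqrt (real ?s) * sqrt (real ?s))" by simp
    also have "\<dots> \<le> K * real ?s * (sqrt (real L) * sqrt (real ?s))"
      using True K by (intro mult_mono) auto
    finally show ?thesis
      by (intro computes_mono[OF computes_cover_pairs_quadratic[OF less.prems]]) (auto simp: mult_ac)
  next
    case False
    define m where "m = sqrt (real ?s * real L)"
    define q where "q = nat \<lceil>m\<rceil>"
    define lam where "lam = 15 / 16 * K * m"
    have s: "real L \<le> real ?s" "1 \<le> real L" using False L by auto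
    \<comment> \<open>\<open>m\<close> is the geometric mean of \<open>L\<close> and
      \<open>card X\<close>, hence lies between them; so \<open>q \<le> card X\<close>, and terms of
      order \<open>L\<close> are absorbed by \<open>m\<close>.\<close>
    have mL: "real L \<le> m" unfolding m_def using s by (intro real_le_rsqrt) (simp add: power2_eq_square mult_right_mono)
    have ms: "m \<le> real ?s" unfolding m_def using s by (intro real_le_lsqrt) (auto simp: power2_eq_square intro: mult_left_mono)
    have m: "1 \<le> m" using mL s by linarith
    have q: "m \<le> real q" "real q \<le> 2 * m" "1 \<le> q" "q \<le> ?s"
    proof -
      show "m \<le> real q" unfolding q_def by (rule real_nat_ceiling_ge)
      have "real q \<le> m + 1" unfolding q_def using m by linarith
      then show "real q \<le> 2 * m" using m by linarith
      show "1 \<le> q" unfolding q_def using m by linarith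
      show "q \<le> ?s" unfolding q_def using ms by linarith
    qed
    have "0 \<le> lam" using K m by (simp add: lam_def)
    have "card X < 2 ^ L" using L(2) card_mono[OF finite_V X(5)] by linarith
    then have "computes orc I (CP X) (\<lambda>_. lam * real ?s +
      real ?s * ((2 * real L + 1) * (real (?s div q) + 1)) +
      5 * real ?s * (2 * real q * (real d + 1) + real d + 4 * real q))"
    proof (rule computes_split[OF less.prems _ q(3,4) \<open>0 \<le> lam\<close>])
      fix J Y v assume Y: "part J Y v" "Y \<subseteq> X" "8 * card Y \<le> 7 * card X"
      have "0 < card X" using False by linarith
      then have "card Y < card X" using Y(3) by linarith
      moreover have "K * sqrt (real L) * real (card Y) * sqrt (real (card Y)) \<le> lam * real (card Y)"
      proof -
        have "sqrt (real (card Y)) \<le> sqrt ((15 / 16)\<^sup>2 * real ?s)"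
          using Y(3) by (intro real_sqrt_le_mono) (simp add: power2_eq_square)
        also have "\<dots> = 15 / 16 * sqrt (real ?s)" by (simp add: real_sqrt_mult)
        finally have "K * sqrt (real L) * real (card Y) * sqrt (real (card Y)) \<le>
            K * sqrt (real L) * real (card Y) * (15 / 16 * sqrt (real ?s))"
          using K by (intro mult_left_mono) auto
        then show ?thesis by (simp add: lam_def m_def real_sqrt_mult mult_ac)
      qed
      ultimately show "computes orc J (CP Y) (\<lambda>_. lam * real (card Y))"
        by (intro computes_mono[OF less.hyps[OF _ Y(1)] subset_refl]) auto
    qed
    then show ?thesis
    proof (rule computes_mono)
      have "real (?s div q) \<le> real ?s / real q" by (rule of_nat_div_le_of_nat)
      also have "\<dots> \<le> real ?s / m" using q(1) m by (intro divide_left_mono) auto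
      finally have "(2 * real L + 1) * (real (?s div q) + 1) \<le> (3 * real L) * (real ?s / m + 1)"
        using s by (intro mult_mono) auto
      also have "\<dots> = 3 * (real ?s * real L / m) + 3 * real L" by (simp add: algebra_simps)
      also have "real ?s * real L = m * m" by (simp add: m_def)
      finally have "(2 * real L + 1) * (real (?s div q) + 1) \<le> 6 * m" using mL m by simp
      moreover have "2 * real q * (real d + 1) + real d + 4 * real q \<le>
          2 * (2 * m) * (real d + 1) + real d * m + 4 * (2 * m)"
        using q(2) m by (intro add_mono mult_right_mono mult_left_mono) (auto simp: mult_le_cancel_left1)
      then have "5 * (2 * real q * (real d + 1) + real d + 4 * real q) \<le> (25 * real d + 60) * m"
        by (simp add: algebra_simps)
      ultimately have "(2 * real L + 1) * (real (?s div q) + 1) +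
          5 * (2 * real q * (real d + 1) + real d + 4 * real q) \<le> K * m / 16"
        by (simp add: K_def algebra_simps)
      then have "real ?s * ((2 * real L + 1) * (real (?s div q) + 1) +
          5 * (2 * real q * (real d + 1) + real d + 4 * real q)) \<le> real ?s * (K * m / 16)"
        by (intro mult_left_mono) auto
      moreover have "K * sqrt (real L) * real ?s * sqrt (real ?s) = lam * real ?s + real ?s * (K * m / 16)"
        by (simp add: lam_def m_def real_sqrt_mult algebra_simps)
      ultimately show "lam * real ?s + real ?s * ((2 * real L + 1) * (real (?s div q) + 1)) +
          5 * real ?s * (2 * real q * (real d + 1) + real d + 4 * real q)
          \<le> K * sqrt (real L) * real ?s * sqrt (real ?s)"
        by (simp only: distrib_left mult_ac)
    qed auto
  qed
qed

end

section \<open>Trees with separator queries\<close>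

lemma computes_query: "computes orc I (\<lambda>i. orc i a b c) (\<lambda>_. 1)"
  unfolding computes_def by (intro exI[of _ "Query a b c Output"]) simp

lemma ancestor_queries_trees:
  assumes "finite V" "r \<in> V"
  shows "ancestor_queries V {E. is_tree V E \<and> max_degree V E \<le> d} (sep V) (\<lambda>E. dominates V E r) d"
proof
  fix a b assume ab: "a \<in> V" "b \<in> V"
  show "computes (sep V) {E. is_tree V E \<and> max_degree V E \<le> d} (\<lambda>E. dominates V E r a b) (\<lambda>_. 1)"
  proof (rule computes_comp[OF computes_query[of _ _ r a b]])
    show "dominates V E r a b = (\<lambda>x. a = r \<or> a = b \<or> x) (sep V E r a b)" for E
      using dominates_iff_sep[OF assms(2) ab] by simp
  qed
qed (use assms in \<open>auto intro: tree_order_dominates\<close>)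

lemma tree_computes_edges:
  assumes "r \<in> V" "I \<subseteq> {E. is_tree V E}"
    and "computes orc I (\<lambda>E. cover_pairs V (dominates V E r) V) c"
  shows "computes orc I (\<lambda>E. E) c"
proof (rule computes_comp[OF assms(3), where h = "\<lambda>P. (\<lambda>(u, v). {u, v}) ` P"])
  fix E assume "E \<in> I"
  then have "is_tree V E" using assms(2) by blast
  then show "E = (\<lambda>(u, v). {u, v}) ` cover_pairs V (dominates V E r) V"
    by (rule edges_eq_covers[OF _ assms(1)])
qed

text \<open>The algorithm is fixed before \<open>h\<close>, so the height need not be known. The
  constant is 5 from the cuts times 3 from \<open>2 * h + 1 \<le> 3 * h\<close> for positive
  \<open>h\<close>.\<close>

lemma tree_computes_height:
  fixes V :: "'v set" and d :: nat
  defines "I \<equiv> {E. is_tree V E \<and> max_degree V E \<le> d}"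
  shows "\<exists>A. \<forall>E\<in>I. result (sep V E) A = E \<and> (\<forall>h. has_height V E h \<longrightarrow>
    real (query_count (sep V E) A) \<le> 15 * real d * (real (card V) * real h))"
proof (cases "I = {}")
  case False
  then have V: "finite V" "V \<noteq> {}" by (auto simp: I_def is_tree_def simple_graph_def)
  then obtain r where r: "r \<in> V" by blast
  interpret ancestor_queries V I "sep V" "\<lambda>E. dominates V E r" d
    unfolding I_def by (rule ancestor_queries_trees[OF V(1) r])
  have p: "part I V r"
    unfolding part_def using component_dominates[OF _ r] V(1) r by (auto simp: I_def)
  let ?c = "\<lambda>E. 5 * (\<Sum>(u, c)\<in>CP V E. real (card (below (dominates V E r) V u)))"
  have cost: "?c E \<le> 15 * real d * (real (card V) * real h)" if E: "E \<in> I" and h: "has_height V E h" for E h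
  proof -
    have tree: "is_tree V E" using E by (simp add: I_def)
    have dom: "card {u \<in> V. dominates V E r u v} \<le> 2 * h + 1" if "v \<in> V" for v
      using card_dominators[OF tree r h that] .
    show ?thesis
    \<comment> \<open>For \<open>h = 0\<close> the bound is 0; the tree is then a single vertex and
      has no covering pairs.\<close>
    proof (cases "h = 0")
      case True
      have "v = r" if "v \<in> V" for v
      proof -
        have "{r, v} \<subseteq> {u \<in> V. dominates V E r u v}"
          using componentD(4)[OF component_dominates[OF tree r] that] dominates_refl[OF tree] r that by auto
        then have "card {r, v} \<le> card {u \<in> V. dominates V E r u v}"
          using V(1) by (intro card_mono) auto
        then have "card {r, v} \<le> 1" using dom[OF that] True by simp
        then show ?thesis by (auto simp: card_insert_if split: if_splits)
      qed
      then have "V = {r}" using r by blast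
      then have "CP V E = {}" using cover_pairs_singleton[of V _ r] by simp
      then show ?thesis by (simp add: True)
    next
      case False
      have "(\<Sum>(u, c)\<in>CP V E. real (card (below (dominates V E r) V u))) \<le>
          real d * (\<Sum>u\<in>V. real (card (below (dominates V E r) V u)))"
        by (rule sum_cover_pairs_le[OF p E]) simp
      \<comment> \<open>Double counting: descendants summed over ancestors equal ancestors summed
        over descendants.\<close>
      also have "(\<Sum>u\<in>V. real (card (below (dominates V E r) V u))) =
          (\<Sum>v\<in>V. real (card {u \<in> V. dominates V E r u v}))"
        using V(1) sum.swap[of "\<lambda>u v. if dominates V E r u v then 1 else (0::real)" V V]
        by (simp add: below_def sum.If_cases Int_def)
      also have "real d * \<dots> \<le> real d * (\<Sum>v\<in>V. 3 * real h)"
      proof (intro mult_left_mono sum_mono)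
        fix v assume "v \<in> V"
        then show "real (card {u \<in> V. dominates V E r u v}) \<le> 3 * real h" using dom[of v] False by linarith
      qed simp
      finally show ?thesis by (simp add: mult_ac)
    qed
  qed
  have "computes (sep V) I (\<lambda>E. E) ?c"
    by (rule tree_computes_edges[OF r _ computes_cover_pairs[OF p]]) (auto simp: I_def)
  then obtain A where A: "\<forall>E\<in>I. result (sep V E) A = E \<and> real (query_count (sep V E) A) \<le> ?c E"
    unfolding computes_def by blast
  show ?thesis
  proof (intro exI[of _ A] ballI conjI allI impI)
    fix E h assume E: "E \<in> I"
    show "result (sep V E) A = E" using A E by simp
    assume "has_height V E h"
    from cost[OF E this] show "real (query_count (sep V E) A) \<le> 15 * real d * (real (card V) * real h)"
      using A[rule_format, OF E] by linarith
  qed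
qed auto

text \<open>Take \<open>L = m + 1\<close> with \<open>2 ^ m \<le> n < 2 ^ (m + 1)\<close>, where
  \<open>n = card V\<close>. For \<open>n\<close> at least 2,
  \<open>L \<le> 2 * m \<le> 4 * ln n\<close> because \<open>ln 2\<close> is at least one half; the
  square root doubles the constant 16. For \<open>n = 1\<close> the bound is 0 and no query is
  issued.\<close>

lemma tree_computes_general:
  fixes V :: "'v set" and d :: nat
  defines "I \<equiv> {E. is_tree V E \<and> max_degree V E \<le> d}"
  shows "\<exists>A. \<forall>E\<in>I. result (sep V E) A = E \<and> real (query_count (sep V E) A) \<le>
    32 * (25 * real d + 66) * (real (card V) powr (3/2) * sqrt (ln (real (card V))))"
proof (cases "I = {}")
  case False
  then have V: "finite V" "V \<noteq> {}" by (auto simp: I_def is_tree_def simple_graph_def)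
  then obtain r where r: "r \<in> V" by blast
  interpret ancestor_queries V I "sep V" "\<lambda>E. dominates V E r" d
    unfolding I_def by (rule ancestor_queries_trees[OF V(1) r])
  have p: "part I V r"
    unfolding part_def using component_dominates[OF _ r] V(1) r by (auto simp: I_def)
  let ?n = "card V"
  let ?c = "32 * (25 * real d + 66) * (real ?n powr (3/2) * sqrt (ln (real ?n)))"
  have n: "1 \<le> ?n" using V by (simp add: Suc_le_eq card_gt_0_iff)
  have "computes (sep V) I (CP V) (\<lambda>_. ?c)"
  proof (cases "?n = 1")
    case True
    then have "V = {r}" using r by (metis card_1_singletonE singletonD)
    then have "CP V E = {}" for E using cover_pairs_singleton[of V _ r] by simp
    then show ?thesis by (intro computes_const[where x = "{}"]) (auto simp: True)
  next
    case False
    obtain m where m: "2 ^ m \<le> ?n" "?n < 2 ^ (m + 1)" using ex_power_ivl1[of 2 ?n] n by auto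
    have "1 \<le> m" using m(2) n False by (cases m) auto
    have "real (2 ^ m) \<le> real ?n" using m(1) by linarith
    then have "ln (2 ^ m) \<le> ln (real ?n)" using n by (subst ln_le_cancel_iff) auto
    then have "real m * ln 2 \<le> ln (real ?n)" by (simp add: ln_realpow)
    moreover have "1 / 2 \<le> ln (2::real)" using ln_le_minus_one[of "1 / 2 :: real"] by (simp add: ln_div)
    then have "real m * (1 / 2) \<le> real m * ln 2" by (intro mult_left_mono) auto
    ultimately have "real (m + 1) \<le> 4 * ln (real ?n)" using \<open>1 \<le> m\<close> by linarith
    then have "sqrt (real (m + 1)) \<le> sqrt (4 * ln (real ?n))" by (rule real_sqrt_le_mono)
    also have "\<dots> = 2 * sqrt (ln (real ?n))" by (simp add: real_sqrt_mult)
    finally have le: "sqrt (real (m + 1)) \<le> 2 * sqrt (ln (real ?n))" .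
    have "real ?n powr (3/2) = real ?n powr (1 + 1/2)" by simp
    also have "\<dots> = real ?n * sqrt (real ?n)" using n by (simp only: powr_add powr_half_sqrt) simp
    finally have powr: "real ?n powr (3/2) = real ?n * sqrt (real ?n)" .
    show ?thesis
    proof (rule computes_mono[OF computes_cover_pairs_subquadratic[OF p _ m(2)]])
      have "16 * (25 * real d + 66) * sqrt (real (m + 1)) * (real ?n * sqrt (real ?n)) \<le>
          16 * (25 * real d + 66) * (2 * sqrt (ln (real ?n))) * (real ?n * sqrt (real ?n))"
        using le by (intro mult_right_mono mult_left_mono) auto
      then show "16 * (25 * real d + 66) * sqrt (real (m + 1)) * real ?n * sqrt (real ?n) \<le> ?c"
        unfolding powr by (simp add: algebra_simps)
    qed auto
  qed
  then have "computes (sep V) I (\<lambda>E. E) (\<lambda>_. ?c)"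
    by (intro tree_computes_edges[OF r]) (auto simp: I_def)
  then show ?thesis unfolding computes_def .
qed auto

theorem theorem3:
  fixes d :: nat
  shows "(\<exists>(A :: 'v set \<Rightarrow> ('v, 'v set set) query_alg) (C :: real). \<forall>V E h.
            is_tree V E \<and> max_degree V E \<le> d \<and> has_height V E h \<longrightarrow>
              result (sep V E) (A V) = E \<and>
              real (query_count (sep V E) (A V)) \<le> C * (real (card V) * real h))
       \<and> (\<exists>(A :: 'v set \<Rightarrow> ('v, 'v set set) query_alg) (C :: real). \<forall>V E.
            is_tree V E \<and> max_degree V E \<le> d \<longrightarrow>
              result (sep V E) (A V) = E \<and>
              real (query_count (sep V E) (A V)) \<le>
                C * (real (card V) powr (3/2) * sqrt (ln (real (card V)))))"
proof (intro conjI)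
  \<comment> \<open>For each \<open>V\<close> one algorithm serves all trees on \<open>V\<close>;
    choice collects these into a function of \<open>V\<close>.\<close>
  obtain A where "\<forall>V :: 'v set. \<forall>E\<in>{E. is_tree V E \<and> max_degree V E \<le> d}.
      result (sep V E) (A V) = E \<and> (\<forall>h. has_height V E h \<longrightarrow>
      real (query_count (sep V E) (A V)) \<le> 15 * real d * (real (card V) * real h))"
    using choice[OF allI[OF tree_computes_height[where d = d]]] by (rule exE)
  then show "\<exists>(A :: 'v set \<Rightarrow> ('v, 'v set set) query_alg) (C :: real). \<forall>V E h.
      is_tree V E \<and> max_degree V E \<le> d \<and> has_height V E h \<longrightarrow> result (sep V E) (A V) = E \<and>
      real (query_count (sep V E) (A V)) \<le> C * (real (card V) * real h)"
    by (intro exI[of _ A] exI[of _ "15 * real d"]) simp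
next
  obtain A where "\<forall>V :: 'v set. \<forall>E\<in>{E. is_tree V E \<and> max_degree V E \<le> d}.
      result (sep V E) (A V) = E \<and> real (query_count (sep V E) (A V)) \<le>
      32 * (25 * real d + 66) * (real (card V) powr (3/2) * sqrt (ln (real (card V))))"
    using choice[OF allI[OF tree_computes_general[where d = d]]] by (rule exE)
  then show "\<exists>(A :: 'v set \<Rightarrow> ('v, 'v set set) query_alg) (C :: real). \<forall>V E.
      is_tree V E \<and> max_degree V E \<le> d \<longrightarrow> result (sep V E) (A V) = E \<and>
      real (query_count (sep V E) (A V)) \<le> C * (real (card V) powr (3/2) * sqrt (ln (real (card V))))"
    by (intro exI[of _ A] exI[of _ "32 * (25 * real d + 66)"]) simp
qed

end
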